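(* Let $\omega$ be a linear symplectic form on $\mathbb{R}^4$ and $H$ a nondegenerate quadratic form on $\mathbb{R}^4$ of signature $0$, and let $\mathcal{N}=H^{-1}(0)$ be the null-cone of $H$. Let $L=\Omega^{-1}S$ be the matrix of the associated linear Hamiltonian system $\dot x = Lx$. Then: (1) if the system is elliptic with simple eigenvalues, $\mathcal{N}$ contains no Lagrangian planes; (2) if the system is elliptic with double eigenvalues and non-zero nilpotent part, $\mathcal{N}$ contains precisely $1$ Lagrangian plane; (3) if the system is hyperbolic with a full quadruplet of eigenvalues, $\mathcal{N}$ contains precisely $2$ Lagrangian planes; (4) if the system is hyperbolic with a pair of coincident real eigenvalues and non-zero nilpotent part, $\mathcal{N}$ contains precisely $3$ Lagrangian planes; (5) if the system is hyperbolic with simple real eigenvalues, $\mathcal{N}$ contains precisely $4$ Lagrangian planes.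
   Context: In a basis, $H(x)=x^TSx$ with $S$ symmetric and $\omega(x,y)=x^T\Omega y$ with $\Omega$ nondegenerate skew-symmetric; the linear Hamiltonian system is $\dot x = Lx$ with $L=\Omega^{-1}S$. The system is nondegenerate if $S$ is nondegenerate. A nondegenerate system is elliptic if all eigenvalues of $L$ are purely imaginary, and hyperbolic if no eigenvalue of $L$ is purely imaginary. "Simple eigenvalues" means the four eigenvalues of $L$ are distinct; "double eigenvalues with non-zero nilpotent part" means each eigenvalue has algebraic multiplicity $2$ and $L$ is not diagonalizable (over $\mathbb{C}$). "Full quadruplet of eigenvalues" means the eigenvalues are $\pm\kappa\pm i\lambda$ with $\kappa\neq0$, $\lambda\neq 0$. "Pair of coincident real eigenvalues" means the eigenvalues are $\pm\lambda$ with $\lambda$ real nonzero, each of multiplicity $2$; "simple real eigenvalues" means four distinct real eigenvalues. A Lagrangian plane is a $2$-dimensional linear subspace of $\mathbb{R}^4$ on which $\omega$ vanishes identically. The signature of $H$ is half the difference between the number of positive and negative eigenvalues of $S$ (so signature $0$ means $S$ has two positive and two negative eigenvalues). *)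

theory Defs
  imports "HOL-Analysis.Analysis" "HOL-Computational_Algebra.Polynomial"
begin

definition charpoly :: "'a::comm_ring_1 ^'n^'n \<Rightarrow> 'a poly" where
  "charpoly A = det (\<chi> i j. (if i = j then [:0, 1:] else 0) - [:A $ i $ j:])"

definition cmat :: "real^'n^'n \<Rightarrow> complex^'n^'n" where
  "cmat A = (\<chi> i j. complex_of_real (A $ i $ j))"

definition eigenvalues :: "real^'n^'n \<Rightarrow> complex set" where
  "eigenvalues A = {\<mu>. poly (charpoly (cmat A)) \<mu> = 0}"

definition alg_mult :: "real^'n^'n \<Rightarrow> complex \<Rightarrow> nat" where
  "alg_mult A \<mu> = order \<mu> (charpoly (cmat A))"

definition diagonalizable_C :: "real^'n^'n \<Rightarrow> bool" where
  "diagonalizable_C A \<longleftrightarrow> (\<exists>(P::complex^'n^'n) d. invertible P \<and>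
      matrix_inv P ** cmat A ** P = (\<chi> i j. if i = j then d i else 0))"

definition n_pos_eig :: "real^'n^'n \<Rightarrow> nat" where
  "n_pos_eig A = (\<Sum>x\<in>{x::real. x > 0 \<and> poly (charpoly A) x = 0}. order x (charpoly A))"
definition n_neg_eig :: "real^'n^'n \<Rightarrow> nat" where
  "n_neg_eig A = (\<Sum>x\<in>{x::real. x < 0 \<and> poly (charpoly A) x = 0}. order x (charpoly A))"

definition quadH :: "real^'n^'n \<Rightarrow> real^'n \<Rightarrow> real" where
  "quadH S x = x \<bullet> (S *v x)"
definition sympw :: "real^'n^'n \<Rightarrow> real^'n \<Rightarrow> real^'n \<Rightarrow> real" where
  "sympw Om x y = x \<bullet> (Om *v y)"

definition null_cone :: "real^'n^'n \<Rightarrow> (real^'n) set" where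
  "null_cone S = {x. quadH S x = 0}"

definition lagrangian_plane :: "real^4^4 \<Rightarrow> (real^4) set \<Rightarrow> bool" where
  "lagrangian_plane Om V \<longleftrightarrow> subspace V \<and> dim V = 2 \<and>
      (\<forall>x\<in>V. \<forall>y\<in>V. sympw Om x y = 0)"

definition lagr_in_cone :: "real^4^4 \<Rightarrow> real^4^4 \<Rightarrow> (real^4) set set" where
  "lagr_in_cone Om S = {V. lagrangian_plane Om V \<and> V \<subseteq> null_cone S}"

definition hamL :: "real^4^4 \<Rightarrow> real^4^4 \<Rightarrow> real^4^4" where
  "hamL Om S = matrix_inv Om ** S"

definition elliptic :: "real^4^4 \<Rightarrow> bool" where
  "elliptic L \<longleftrightarrow> (\<forall>\<mu>\<in>eigenvalues L. Re \<mu> = 0)"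
definition hyperbolic :: "real^4^4 \<Rightarrow> bool" where
  "hyperbolic L \<longleftrightarrow> (\<forall>\<mu>\<in>eigenvalues L. Re \<mu> \<noteq> 0)"

end

theory Submission
  imports Defs "HOL-Computational_Algebra.Fundamental_Theorem_Algebra"
begin

text \<open>Since \<open>\<omega>(x, L y) = x\<^sup>T S y\<close>, polarisation shows that a Lagrangian plane \<open>V\<close> lies in the null cone iff
  \<open>L V\<close> lies in the \<open>\<omega>\<close>-complement of \<open>V\<close>, which is \<open>V\<close> itself. So the invariant Lagrangian planes
  have to be counted. The spectrum is symmetric under negation, and Cayley-Hamilton gives a biquadratic
  relation for \<open>L\<close>. If it factors as \<open>q(X) q(-X)\<close> with \<open>q = X\<^sup>2 + k X + r\<close> and \<open>k, r \<noteq> 0\<close>,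
  then both \<open>ker q(L)\<close> and \<open>ker q(-L)\<close> are isotropic and together span the space, hence both are
  Lagrangian. For double eigenvalues, \<open>M = L\<^sup>2 - s\<close> has square zero and \<open>\<omega>(M x, y)\<close> is skew, so a nonzero
  \<open>M\<close> has rank 2 and \<open>ker M = im M\<close> is Lagrangian. All invariant Lagrangian planes turn out to be kernels
  of these two kinds. For simple imaginary eigenvalues the only invariant planes are the real eigenplanes,
  on which \<open>\<omega>\<close> does not vanish.\<close>

section \<open>The Cayley-Hamilton theorem\<close>

lemma matrix_inv_mult:
  assumes "invertible A"
  shows "matrix_inv A ** A = mat 1" and "A ** matrix_inv A = mat 1"
  using someI_ex[OF assms[unfolded invertible_def]] by (simp_all add: matrix_inv_def)

text \<open>Cramer's rule: column \<open>k\<close> of \<open>C\<close> collects determinants of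
  \<open>B\<close> with row \<open>k\<close> replaced by unit vectors, so by linearity
  \<open>B ** C\<close> has at (\<open>i\<close>, \<open>k\<close>) the determinant of
  \<open>B\<close> with row \<open>k\<close> replaced by row \<open>i\<close>. No division occurs,
  so polynomial entries are allowed.\<close>

lemma right_adjugate_exists:
  fixes B :: "'a::comm_ring_1^'n^'n"
  shows "\<exists>C. B ** C = mat (det B)"
proof -
  define C where "C = (\<chi> j k. det (\<chi> r. if r = k then axis j 1 else row r B))"
  have "(\<Sum>j\<in>UNIV. B $ i $ j * C $ j $ k) = (if i = k then det B else 0)" for i k
  proof -
    have row: "row i B = (\<Sum>j\<in>UNIV. B $ i $ j *s axis j 1)"
      by (simp add: vec_eq_iff row_def axis_def if_distrib cong: if_cong)
    have "(\<Sum>j\<in>UNIV. B $ i $ j * C $ j $ k)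
        = (\<Sum>j\<in>UNIV. det (\<chi> r. if r = k then B $ i $ j *s axis j 1 else row r B))"
      unfolding C_def by (simp add: det_row_mul)
    also have "\<dots> = det (\<chi> r. if r = k then row i B else row r B)"
      unfolding row by (subst det_linear_row_sum) simp_all
    also have "\<dots> = (if i = k then det B else 0)"
    proof (cases "i = k")
      case True
      then have "(\<chi> r. if r = k then row i B else row r B) = B"
        by (simp add: vec_eq_iff row_def)
      with True show ?thesis by simp
    next
      case False
      then show ?thesis
        by (simp add: row_def vec_eq_iff det_identical_rows[of i k])
    qed
    finally show ?thesis .
  qed
  then show ?thesis
    by (intro exI[of _ C]) (simp add: vec_eq_iff matrix_matrix_mult_def mat_def)
qed

text \<open>Writing \<open>u\<close> for the right adjugate of \<open>xI - A\<close> applied to \<open>v\<close> and \<open>c\<^sub>k\<close> for its coefficient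
  vectors, \<open>(xI - A) u = p v\<close> says that \<open>p\<^sub>k v = c\<^bsub>k-1\<^esub> - A c\<^sub>k\<close>, so that the sum telescopes.\<close>
theorem cayley_hamilton:
  fixes A :: "'a::comm_ring_1^'n^'n"
  shows "(\<Sum>k\<le>degree (charpoly A). coeff (charpoly A) k *s ((*v) A ^^ k) v) = 0"
proof -
  define p where "p = charpoly A"
  define B where "B = (\<chi> i j. (if i = j then [:0, 1:] else 0) - [:A $ i $ j:])"
  have detB: "det B = p" by (simp add: p_def charpoly_def B_def)
  obtain C where C: "B ** C = mat p" using right_adjugate_exists[of B] detB by auto
  define u where "u = C *v (\<chi> i. [:v $ i:])"
  define c where "c k = (\<chi> i. coeff (u $ i) k)" for k
  have "B *v u = mat p *v (\<chi> i. [:v $ i:])"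
    by (simp add: u_def matrix_vector_mul_assoc C)
  also have "\<dots> = (\<chi> i. p * [:v $ i:])"
    by (simp add: vec_eq_iff matrix_vector_mult_def mat_def if_distrib if_distribR cong: if_cong)
  finally have Bu: "(B *v u) $ i = smult (v $ i) p" for i by simp
  have "(B *v u) $ i = (\<Sum>j\<in>UNIV. (if i = j then pCons 0 (u $ j) else 0) - smult (A $ i $ j) (u $ j))" for i
    unfolding matrix_vector_mult_def B_def by (auto simp: left_diff_distrib intro!: sum.cong)
  then have Bu': "smult (v $ i) p = pCons 0 (u $ i) - (\<Sum>j\<in>UNIV. smult (A $ i $ j) (u $ j))" for i
    by (simp add: Bu sum_subtractf)
  have coeff_Suc: "coeff p (Suc k) *s v = c k - A *v c (Suc k)" for k
    using arg_cong[OF Bu', of "\<lambda>q. coeff q (Suc k)"]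
    by (simp add: vec_eq_iff c_def matrix_vector_mult_def coeff_sum mult.commute)
  have coeff_0: "coeff p 0 *s v = - (A *v c 0)"
    using arg_cong[OF Bu', of "\<lambda>q. coeff q 0"]
    by (simp add: vec_eq_iff c_def matrix_vector_mult_def coeff_sum mult.commute)
  have diff: "A *v (x - y) = A *v x - A *v y" for x y
    by (simp add: vec_eq_iff matrix_vector_mult_def right_diff_distrib sum_subtractf)
  have scale: "A *v (a *s x) = a *s (A *v x)" for a x
    by (simp add: vec_eq_iff matrix_vector_mult_def sum_distrib_left mult.left_commute)
  have pow_diff: "((*v) A ^^ k) (x - y) = ((*v) A ^^ k) x - ((*v) A ^^ k) y" for k x y
    by (induction k) (simp_all add: diff)
  have pow_scale: "((*v) A ^^ k) (a *s x) = a *s ((*v) A ^^ k) x" for k a x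
    by (induction k) (simp_all add: scale)
  have partial: "(\<Sum>k\<le>n. coeff p k *s ((*v) A ^^ k) v) = - (((*v) A ^^ Suc n) (c n))" for n
  proof (induction n)
    case 0
    then show ?case by (simp add: coeff_0)
  next
    case (Suc n)
    have "coeff p (Suc n) *s ((*v) A ^^ Suc n) v
        = ((*v) A ^^ Suc n) (c n) - ((*v) A ^^ Suc n) (A *v c (Suc n))"
      by (metis pow_scale pow_diff coeff_Suc)
    with Suc show ?case by (simp add: funpow_swap1)
  qed
  obtain N where N: "\<forall>i. degree (u $ i) < N"
    using finite_nat_set_iff_bounded[of "range (\<lambda>i. degree (u $ i))"] by auto
  \<comment> \<open>From \<open>N\<close> on all coefficient vectors vanish, which kills the
    remainder of the telescoping sum; the maximum with the degree makes the sum reach every nonzero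
    coefficient of \<open>p\<close>.\<close>
  define n where "n = max N (degree p)"
  have "c n = 0"
    using N by (simp add: c_def vec_eq_iff n_def coeff_eq_0 less_max_iff_disj)
  \<comment> \<open>Instantiating \<open>pow_diff\<close> at two zero vectors shows that powers of
    \<open>A\<close> send 0 to 0.\<close>
  then have "(\<Sum>k\<le>n. coeff p k *s ((*v) A ^^ k) v) = 0"
    using pow_diff[of "Suc n" 0 0] by (simp only: partial) (simp del: funpow.simps)
  moreover have "(\<Sum>k\<le>n. coeff p k *s ((*v) A ^^ k) v) = (\<Sum>k\<le>degree p. coeff p k *s ((*v) A ^^ k) v)"
    by (rule sum.mono_neutral_right) (auto simp: n_def coeff_eq_0)
  ultimately show ?thesis by (simp add: p_def)
qed

section \<open>The characteristic polynomial and diagonalisation\<close>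

text \<open>Only linear coefficients can contribute in degree \<open>card I\<close>. The hypothesis
  bounds the degrees instead of fixing them because off-diagonal entries of xI - A are
  constants.\<close>

lemma coeff_prod_card:
  fixes g :: "'i \<Rightarrow> 'a::comm_ring_1 poly"
  assumes "\<And>i. i \<in> I \<Longrightarrow> degree (g i) \<le> 1"
  shows "degree (prod g I) \<le> card I \<and> coeff (prod g I) (card I) = (\<Prod>i\<in>I. coeff (g i) 1)"
  using assms
proof (induction I rule: infinite_finite_induct)
  case (insert i I)
  then have "degree (g i) \<le> 1" "degree (prod g I) \<le> card I"
    "coeff (prod g I) (card I) = (\<Prod>i\<in>I. coeff (g i) 1)" by auto
  moreover have "coeff (p * q) (Suc n) = coeff p 1 * coeff q n"
    if "degree p \<le> 1" "degree q \<le> n" for p q :: "'a poly" and n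
  proof -
    obtain a b where p: "p = [:a, b:]"
      using \<open>degree p \<le> 1\<close> by (metis One_nat_def degree_pCons_eq_if le_zero_eq degree_eq_zeroE pCons_cases le_SucE old.nat.inject pCons_0_0)
    then show ?thesis using that(2) by (simp add: coeff_eq_0)
  qed
  ultimately show ?case
    using insert(1,2) degree_mult_le[of "g i" "prod g I"] by simp
qed auto

text \<open>In the Leibniz formula the coefficients of degree \<open>CARD('n)\<close> assemble to
  the determinant of the matrix of linear coefficients of \<open>B\<close>, which is the
  identity.\<close>

lemma
  fixes A :: "'a::comm_ring_1^'n^'n"
  shows degree_charpoly_le: "degree (charpoly A) \<le> CARD('n)"
    and coeff_charpoly_card: "coeff (charpoly A) CARD('n) = 1"
proof -
  define B where "B = (\<chi> i j. (if i = j then [:0, 1:] else 0) - [:A $ i $ j:])"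
  have "degree (B $ i $ j) \<le> 1" for i j
    by (simp add: B_def degree_diff_le)
  then have *: "degree (\<Prod>i\<in>UNIV. B $ i $ \<sigma> i) \<le> CARD('n)"
    "coeff (\<Prod>i\<in>UNIV. B $ i $ \<sigma> i) CARD('n) = (\<Prod>i\<in>UNIV. coeff (B $ i $ \<sigma> i) 1)" for \<sigma>
    using coeff_prod_card[of UNIV "\<lambda>i. B $ i $ \<sigma> i"] by auto
  have char: "charpoly A = det B" by (simp add: charpoly_def B_def)
  have of_int: "of_int k * q = smult (of_int k) q" for k and q :: "'a poly"
    by (simp add: of_int_poly)
  show "degree (charpoly A) \<le> CARD('n)"
    unfolding char det_def of_int
    by (intro degree_sum_le) (auto intro!: order_trans[OF degree_smult_le] * simp: finite_permutations)
  have "coeff (charpoly A) CARD('n) = det (mat 1 :: 'a^'n^'n)"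
    unfolding char det_def of_int coeff_sum coeff_smult *
    by (intro sum.cong arg_cong2[where f = "(*)"] prod.cong refl) (simp add: B_def mat_def)
  then show "coeff (charpoly A) CARD('n) = 1" by simp
qed

lemma degree_charpoly: "degree (charpoly (A :: 'a::comm_ring_1^'n^'n)) = CARD('n)"
  using degree_charpoly_le[of A] coeff_charpoly_card[of A] le_degree[of "charpoly A" "CARD('n)"]
  by simp

lemma poly_charpoly: "poly (charpoly A) x = det (mat x - A)"
  for A :: "'a::comm_ring_1^'n^'n"
  unfolding charpoly_def det_def
  by (auto simp: poly_sum poly_prod of_int_poly mat_def intro!: sum.cong prod.cong arg_cong2[where f = "(*)"])

lemma charpoly_eq_prod_roots:
  fixes A :: "complex^'n^'n"
  shows "charpoly A = (\<Prod>z|poly (charpoly A) z = 0. [:- z, 1:] ^ order z (charpoly A))"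
  using complex_poly_decompose[of "charpoly A"] by (simp add: degree_charpoly coeff_charpoly_card)

lemma sum_order_charpoly:
  fixes A :: "complex^'n^'n"
  shows "(\<Sum>z|poly (charpoly A) z = 0. order z (charpoly A)) = CARD('n)"
proof -
  have "CARD('n) = degree (\<Prod>z|poly (charpoly A) z = 0. [:- z, 1:] ^ order z (charpoly A))"
    using charpoly_eq_prod_roots[of A] degree_charpoly[of A] by simp
  also have "\<dots> = (\<Sum>z|poly (charpoly A) z = 0. order z (charpoly A))"
    by (subst degree_prod_sum_eq) (simp_all add: degree_power_eq)
  finally show ?thesis by simp
qed

text \<open>A basis chosen among the eigenvectors supplies the columns of \<open>P\<close>. The
  criterion is phrased by spanning, so that it suffices to write each vector as a combination of
  eigenvectors.\<close>

lemma diagonalizable_C_if_span: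
  fixes A :: "real^'n^'n"
  assumes "vec.span {v. \<exists>c. cmat A *v v = c *s v} = UNIV"
  shows "diagonalizable_C A"
proof -
  let ?E = "{v. \<exists>c. cmat A *v v = c *s v}"
  obtain B where B: "B \<subseteq> ?E" "vec.independent B" "?E \<subseteq> vec.span B"
    using vec.maximal_independent_subset by blast
  have spanB: "vec.span B = UNIV"
    using assms vec.span_mono[OF B(3)] by (simp add: vec.span_span top.extremum_unique)
  have "card B = CARD('n)"
    using vec.dim_eq_card[OF _ B(2), of UNIV] spanB by (simp add: vec.dim_UNIV card_cart_basis vec.dimension_def)
  moreover have "finite B" using B(2) by (rule vec.finiteI_independent)
  ultimately obtain h :: "'n \<Rightarrow> complex^'n" where h: "bij_betw h UNIV B"
    using finite_same_card_bij[of "UNIV :: 'n set" B] by auto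
  define P where "P = (\<chi> i j. h j $ i)"
  have col: "column j P = h j" for j by (simp add: P_def column_def vec_eq_iff)
  then have "columns P = B" using h by (auto simp: columns_def bij_betw_def)
  then have "invertible P"
    by (simp add: invertible_right_inverse matrix_right_invertible_span_columns spanB)
  have "\<forall>j. \<exists>c. cmat A *v h j = c *s h j"
    using h B(1) by (auto simp: bij_betw_def)
  then obtain d where d: "\<And>j. cmat A *v h j = d j *s h j" by metis
  define D :: "complex^'n^'n" where "D = (\<chi> i j. if i = j then d i else 0)"
  have "cmat A ** P = P ** D"
  proof -
    have "(cmat A ** P) $ i $ j = (cmat A *v h j) $ i" for i j
      by (simp add: matrix_matrix_mult_def matrix_vector_mult_def P_def)
    moreover have "(P ** D) $ i $ j = d j * h j $ i" for i j
      by (simp add: matrix_matrix_mult_def P_def D_def if_distrib mult.commute cong: if_cong)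
    ultimately show ?thesis by (simp add: vec_eq_iff d)
  qed
  then have "matrix_inv P ** cmat A ** P = (matrix_inv P ** P) ** D"
    by (simp add: matrix_mul_assoc[symmetric])
  also have "\<dots> = D"
    using \<open>invertible P\<close> by (simp add: matrix_inv_mult)
  finally show ?thesis
    using \<open>invertible P\<close> unfolding diagonalizable_C_def D_def by blast
qed

section \<open>Spectra of real matrices\<close>

lemma cmat_mult: "cmat (A ** B) = cmat A ** cmat B"
  by (simp add: cmat_def matrix_matrix_mult_def vec_eq_iff)

lemma cmat_diff: "cmat (A - B) = cmat A - cmat B"
  by (simp add: cmat_def vec_eq_iff)

lemma cmat_mat: "cmat (mat c) = mat (complex_of_real c)"
  by (simp add: cmat_def mat_def vec_eq_iff)

lemma cmat_transpose: "cmat (transpose A) = transpose (cmat A)"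
  by (simp add: cmat_def transpose_def vec_eq_iff)

lemma cmat_uminus: "cmat (- A) = - cmat A"
  by (simp add: cmat_def vec_eq_iff)

lemma det_cmat: "det (cmat A) = complex_of_real (det A)"
  by (simp add: cmat_def det_def)

lemma cmat_mult_vec:
  "cmat A *v (\<chi> i. complex_of_real (x $ i)) = (\<chi> i. complex_of_real ((A *v x) $ i))"
  by (simp add: cmat_def matrix_vector_mult_def vec_eq_iff)

lemma mat_mult_vec: "mat c *v (x :: 'a::comm_semiring_1^'n) = c *s x"
  by (simp add: vec_eq_iff matrix_vector_mult_def mat_def if_distrib if_distribR cong: if_cong)

lemma eigenvalues_iff: "\<mu> \<in> eigenvalues A \<longleftrightarrow> det (mat \<mu> - cmat A) = 0"
  by (simp add: eigenvalues_def poly_charpoly)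

lemma singular_kernel:
  fixes A :: "real^'n^'n"
  assumes "det A = 0"
  obtains x where "x \<noteq> 0" "A *v x = 0"
  using assms invertible_det_nz[of A] matrix_left_invertible_ker[of A] invertible_left_inverse[of A]
  by auto

lemma real_eigenvalue:
  assumes "complex_of_real c \<in> eigenvalues A"
  obtains x where "x \<noteq> 0" "A *v x = c *\<^sub>R x"
proof -
  have "complex_of_real (det (mat c - A)) = 0"
    using assms by (simp add: eigenvalues_iff det_cmat[symmetric] cmat_diff cmat_mat)
  then obtain x where "x \<noteq> 0" "(mat c - A) *v x = 0" by (metis of_real_eq_0_iff singular_kernel)
  then show thesis
    by (intro that[of x]) (simp_all add: matrix_vector_mult_diff_rdistrib mat_mult_vec scalar_mult_eq_scaleR)
qed

text \<open>\<mu>^2 - A^2 has the singular factor \<mu> - A, so the real matrix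
  \<open>mat r - A ** A\<close> is singular and has a real kernel vector even when \<mu> is not
  real.\<close>

lemma real_square_eigenvalue:
  assumes "\<mu> \<in> eigenvalues A" "\<mu>\<^sup>2 = complex_of_real r"
  obtains x where "x \<noteq> 0" "A *v (A *v x) = r *\<^sub>R x"
proof -
  have "mat (\<mu>\<^sup>2) - cmat A ** cmat A = (mat \<mu> - cmat A) ** (mat \<mu> + cmat A)"
    by (simp add: matrix_eq matrix_vector_mul_assoc[symmetric] matrix_vector_mult_diff_rdistrib
        matrix_vector_mult_add_rdistrib mat_mult_vec vec.add vec.scale power2_eq_square)
  then have "complex_of_real (det (mat r - A ** A)) = 0"
    using assms by (simp add: eigenvalues_iff det_cmat[symmetric] cmat_diff cmat_mat cmat_mult det_mul)
  then obtain x where "x \<noteq> 0" "(mat r - A ** A) *v x = 0" by (metis of_real_eq_0_iff singular_kernel)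
  then show thesis
    by (intro that[of x]) (simp_all add: matrix_vector_mult_diff_rdistrib mat_mult_vec
        scalar_mult_eq_scaleR matrix_vector_mul_assoc)
qed

text \<open>The complex Cayley-Hamilton theorem is applied to a real vector and read off in each
  coordinate.\<close>

lemma real_biquadratic:
  fixes A :: "real^'n^'n"
  assumes "charpoly (cmat A) = [:complex_of_real b, 0, complex_of_real a, 0, 1:]"
  shows "A *v (A *v (A *v (A *v x))) + a *\<^sub>R (A *v (A *v x)) + b *\<^sub>R x = 0"
proof -
  define y where "y = (\<chi> i. complex_of_real (x $ i))"
  have "complex_of_real b *s y + complex_of_real a *s (cmat A *v (cmat A *v y))
      + cmat A *v (cmat A *v (cmat A *v (cmat A *v y))) = 0"
    using cayley_hamilton[of "cmat A" y] by (simp add: assms)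
  then have "complex_of_real (b * x $ i + a * (A *v (A *v x)) $ i
      + (A *v (A *v (A *v (A *v x)))) $ i) = 0" for i
    by (simp add: y_def cmat_mult_vec vec_eq_iff)
  then show ?thesis
    unfolding of_real_eq_0_iff by (simp add: vec_eq_iff add.commute add.left_commute)
qed

text \<open>X^2 - r has two distinct complex roots \<mu> and -\<mu>, and \<open>v\<close> is a
  multiple of the difference of the eigenvectors Av + \<mu>v and Av - \<mu>v. The contrapositive
  extracts a nonzero nilpotent part from non-diagonalizability.\<close>

lemma diagonalizable_C_if_square_scalar:
  fixes A :: "real^'n^'n"
  assumes sq: "\<And>x. A *v (A *v x) = r *\<^sub>R x" and "r \<noteq> 0"
  shows "diagonalizable_C A"
proof (rule diagonalizable_C_if_span)
  define \<mu> where "\<mu> = csqrt (complex_of_real r)"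
  have \<mu>: "\<mu>\<^sup>2 = complex_of_real r" "\<mu> \<noteq> 0" using \<open>r \<noteq> 0\<close> by (simp_all add: \<mu>_def)
  let ?E = "{v. \<exists>c. cmat A *v v = c *s v}"
  have "A ** A = mat r"
    by (simp add: matrix_eq matrix_vector_mul_assoc[symmetric] sq mat_mult_vec scalar_mult_eq_scaleR)
  then have "cmat A ** cmat A = mat (\<mu>\<^sup>2)"
    by (simp add: cmat_mult[symmetric] cmat_mat \<mu>)
  then have sqC: "cmat A *v (cmat A *v v) = \<mu>\<^sup>2 *s v" for v
    by (simp add: matrix_vector_mul_assoc mat_mult_vec)
  have "v \<in> vec.span ?E" for v
  proof -
    have "cmat A *v (cmat A *v v + \<mu> *s v) = \<mu> *s (cmat A *v v + \<mu> *s v)"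
      "cmat A *v (cmat A *v v - \<mu> *s v) = (- \<mu>) *s (cmat A *v v - \<mu> *s v)"
      by (simp_all add: vec.add vec.diff vec.scale sqC power2_eq_square vec_eq_iff algebra_simps)
    moreover have "x \<in> vec.span ?E" if "cmat A *v x = c *s x" for c x
      using that by (auto intro: vec.span_base)
    ultimately have "cmat A *v v + \<mu> *s v \<in> vec.span ?E" "cmat A *v v - \<mu> *s v \<in> vec.span ?E"
      by blast+
    then have "(1 / (2 * \<mu>)) *s ((cmat A *v v + \<mu> *s v) - (cmat A *v v - \<mu> *s v)) \<in> vec.span ?E"
      by (rule vec.span_scale[OF vec.span_diff])
    also have "(1 / (2 * \<mu>)) *s ((cmat A *v v + \<mu> *s v) - (cmat A *v v - \<mu> *s v)) = v"
      using \<mu>(2) by (simp add: vec_eq_iff)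
    finally show ?thesis .
  qed
  then show "vec.span ?E = UNIV" by blast
qed

lemma finite_eigenvalues: "finite (eigenvalues A)"
proof -
  have "charpoly (cmat A) \<noteq> 0" using coeff_charpoly_card[of "cmat A"] by auto
  then show ?thesis by (simp add: eigenvalues_def poly_roots_finite)
qed

lemma alg_mult_pos: "\<mu> \<in> eigenvalues A \<Longrightarrow> 1 \<le> alg_mult A \<mu>"
  using coeff_charpoly_card[of "cmat A"] order_root[of "charpoly (cmat A)" \<mu>]
  by (auto simp: eigenvalues_def alg_mult_def)

lemma sum_alg_mult: "(\<Sum>\<mu>\<in>eigenvalues A. alg_mult A \<mu>) = CARD('n)" for A :: "real^'n^'n"
  using sum_order_charpoly[of "cmat A"] by (simp add: eigenvalues_def alg_mult_def)

text \<open>The multiplicities are at least 1 and add up to 4 over four eigenvalues, so each of them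
  is 1.\<close>

lemma charpoly_simple:
  fixes A :: "real^4^4"
  assumes E: "eigenvalues A = {a, - a, b, - b}" and card: "card (eigenvalues A) = 4"
  shows "charpoly (cmat A) = [:a\<^sup>2 * b\<^sup>2, 0, - (a\<^sup>2 + b\<^sup>2), 0, 1:]"
proof -
  have "(\<Sum>\<mu>\<in>eigenvalues A. 1) = (\<Sum>\<mu>\<in>eigenvalues A. alg_mult A \<mu>)"
    using card by (simp add: sum_alg_mult)
  then have mult: "alg_mult A \<mu> = 1" if "\<mu> \<in> eigenvalues A" for \<mu>
    using sum_mono_inv[of "\<lambda>_. 1" "eigenvalues A" "alg_mult A", OF _ alg_mult_pos that finite_eigenvalues]
    by presburger
  have "charpoly (cmat A) = (\<Prod>\<mu>\<in>eigenvalues A. [:- \<mu>, 1:])"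
    using charpoly_eq_prod_roots[of "cmat A"] mult by (simp add: eigenvalues_def alg_mult_def)
  moreover have "distinct [a, - a, b, - b]"
    by (rule card_distinct) (use E card in simp)
  ultimately show ?thesis
    unfolding E by (auto simp: power2_eq_square algebra_simps)
qed

lemma charpoly_double:
  fixes A :: "real^4^4"
  assumes E: "eigenvalues A = {a, - a}" and "a \<noteq> 0"
    and mult: "\<And>\<mu>. \<mu> \<in> eigenvalues A \<Longrightarrow> alg_mult A \<mu> = 2"
  shows "charpoly (cmat A) = [:(a\<^sup>2)\<^sup>2, 0, - (2 * a\<^sup>2), 0, 1:]"
proof -
  have "charpoly (cmat A) = (\<Prod>\<mu>\<in>eigenvalues A. [:- \<mu>, 1:]\<^sup>2)"
    using charpoly_eq_prod_roots[of "cmat A"] mult by (simp add: eigenvalues_def alg_mult_def)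
  moreover have "a \<noteq> - a" using \<open>a \<noteq> 0\<close> by simp
  ultimately show ?thesis
    unfolding E by (simp add: power2_eq_square algebra_simps)
qed

section \<open>Planes in a Euclidean space\<close>

lemma two_le_dim:
  fixes x y :: "'a::euclidean_space"
  assumes "x \<in> V" "y \<in> V" "x \<noteq> 0" "\<And>c. y \<noteq> c *\<^sub>R x"
  shows "2 \<le> dim V"
proof -
  have "y \<notin> span {x}" using assms(4) by (auto simp: span_singleton)
  moreover from this have "y \<noteq> x" using span_base[of x "{x}"] by blast
  ultimately have "independent {y, x}" "card {y, x} = 2"
    using assms(3) by (simp_all add: independent_insert)
  then show ?thesis using independent_card_le_dim[of "{y, x}" V] assms(1,2) by simp
qed

text \<open>Mostly applied with \<open>y\<close> the image of \<open>x\<close> under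
  \<open>L\<close>: invariant planes sharing a vector that is not an eigenvector coincide.\<close>

lemma plane_eqI:
  fixes x y :: "'a::euclidean_space"
  assumes "subspace V" "subspace W" "dim V = 2" "dim W = 2"
    and "x \<in> V \<inter> W" "y \<in> V \<inter> W" "x \<noteq> 0" "\<And>c. y \<noteq> c *\<^sub>R x"
  shows "V = W"
proof -
  have sub: "subspace (V \<inter> W)" using assms(1,2) by (rule subspace_inter)
  have ge: "2 \<le> dim (V \<inter> W)" using assms(5-8) by (rule two_le_dim)
  have "V \<inter> W = V" by (rule subspace_dim_equal[OF sub assms(1)]) (use ge assms(3) in auto)
  moreover have "V \<inter> W = W" by (rule subspace_dim_equal[OF sub assms(2)]) (use ge assms(4) in auto)
  ultimately show ?thesis by simp
qed

section \<open>Linear Hamiltonian systems on four-dimensional space\<close>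

locale linear_hamiltonian =
  fixes Om S :: "real^4^4"
  assumes skew: "transpose Om = - Om" and Om_nondeg: "invertible Om"
    and symS: "transpose S = S" and S_nondeg: "invertible S"
begin

abbreviation "L \<equiv> hamL Om S"

lemma Om_L: "Om ** L = S"
  by (simp add: hamL_def matrix_mul_assoc matrix_inv_mult Om_nondeg)

text \<open>Multiplication by \<open>Om\<close> turns \<mu> - L into \<mu> Om - S, whose transpose
  is -\<mu> Om - S; transposition preserves the determinant.\<close>

lemma neg_eigenvalue:
  assumes "\<mu> \<in> eigenvalues L"
  shows "- \<mu> \<in> eigenvalues L"
proof -
  have det: "det (cmat Om) * det (mat \<nu> - cmat L) = det (mat \<nu> ** cmat Om - cmat S)" for \<nu>
  proof -
    have "cmat Om ** (mat \<nu> - cmat L) = mat \<nu> ** cmat Om - cmat S"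
      by (simp add: matrix_eq matrix_vector_mul_assoc[symmetric] matrix_vector_mult_diff_rdistrib
          vec.diff mat_mult_vec vec.scale)
         (simp add: matrix_vector_mul_assoc cmat_mult[symmetric] Om_L)
    then show ?thesis by (metis det_mul)
  qed
  have "transpose (mat \<mu> ** cmat Om - cmat S) = mat (- \<mu>) ** cmat Om - cmat S"
  proof -
    have tr: "transpose (cmat Om) = - cmat Om" "transpose (cmat S) = cmat S"
      by (metis cmat_transpose cmat_uminus skew) (metis cmat_transpose symS)
    have anti: "cmat Om $ j $ i = - cmat Om $ i $ j" and sym: "cmat S $ j $ i = cmat S $ i $ j" for i j
      using tr[THEN arg_cong, of "\<lambda>M. M $ i $ j"] by (simp_all add: transpose_def)
    have scale: "(mat c ** X) $ i $ j = c * X $ i $ j" for c i j and X :: "complex^4^4"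
      by (simp add: matrix_matrix_mult_def mat_def if_distrib if_distribR cong: if_cong)
    have "transpose (mat \<mu> ** cmat Om - cmat S) $ i $ j = (mat (- \<mu>) ** cmat Om - cmat S) $ i $ j" for i j
      using anti[of j i] sym[of j i] by (simp add: transpose_def scale)
    then show ?thesis by (simp add: vec_eq_iff)
  qed
  then have "det (cmat Om) * det (mat \<mu> - cmat L) = det (cmat Om) * det (mat (- \<mu>) - cmat L)"
    unfolding det by (metis det_transpose)
  moreover have "det (cmat Om) \<noteq> 0"
    using Om_nondeg by (simp add: det_cmat invertible_det_nz)
  ultimately show ?thesis using assms by (simp add: eigenvalues_iff)
qed

lemma inj_L: "L *v x = 0 \<longleftrightarrow> x = 0"
proof
  assume "L *v x = 0"
  then have "S *v x = 0" by (metis Om_L matrix_vector_mul_assoc matrix_vector_mult_0_right)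
  then show "x = 0" by (metis S_nondeg matrix_inv_mult(1) matrix_vector_mul_assoc matrix_vector_mult_0_right matrix_vector_mul_lid)
qed simp

lemma zero_not_eigenvalue: "0 \<notin> eigenvalues L"
proof
  assume "0 \<in> eigenvalues L"
  then have "complex_of_real 0 \<in> eigenvalues L" by simp
  then obtain x where "x \<noteq> 0" "L *v x = 0 *\<^sub>R x" by (rule real_eigenvalue)
  then show False by (simp add: inj_L)
qed

text \<open>Since 0 is not an eigenvalue, the spectrum consists of pairs of distinct numbers \<mu>
  and -\<mu>.\<close>

lemma eigenvalues_card_4:
  assumes "card (eigenvalues L) = 4"
  obtains a b where "eigenvalues L = {a, - a, b, - b}"
proof -
  have "eigenvalues L \<noteq> {}" using assms by auto
  then obtain a where a: "a \<in> eigenvalues L" by blast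
  have "card {a, - a} \<le> 2" by (simp add: card_insert_if)
  then have "\<not> eigenvalues L \<subseteq> {a, - a}" using assms card_mono[of "{a, - a}" "eigenvalues L"] by auto
  then obtain b where b: "b \<in> eigenvalues L" "b \<noteq> a" "b \<noteq> - a" by blast
  have sub: "{a, - a, b, - b} \<subseteq> eigenvalues L" using a b neg_eigenvalue by auto
  have "a \<noteq> - a" "b \<noteq> - b" using a b zero_not_eigenvalue by auto
  with b have "card {a, - a, b, - b} = 4" by (auto simp: card_insert_if minus_equation_iff)
  then have "{a, - a, b, - b} = eigenvalues L"
    using sub assms by (intro card_subset_eq finite_eigenvalues) auto
  then show thesis using that by metis
qed

lemma eigenvalues_mult_2:
  assumes "\<forall>\<mu>\<in>eigenvalues L. alg_mult L \<mu> = 2"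
  obtains a where "a \<noteq> 0" "eigenvalues L = {a, - a}"
proof -
  have "card (eigenvalues L) = 2" using sum_alg_mult[of L] assms by simp
  then obtain a where a: "a \<in> eigenvalues L" by fastforce
  then have "a \<noteq> 0" "- a \<in> eigenvalues L" using zero_not_eigenvalue neg_eigenvalue by auto
  then have "card {a, - a} = 2" by simp
  then have "{a, - a} = eigenvalues L"
    using a \<open>- a \<in> eigenvalues L\<close> \<open>card (eigenvalues L) = 2\<close>
    by (intro card_subset_eq finite_eigenvalues) auto
  then show thesis using that \<open>a \<noteq> 0\<close> by metis
qed

section \<open>Symplectic linear algebra\<close>

abbreviation "f x \<equiv> L *v x"
abbreviation "w \<equiv> sympw Om"

lemma f_add: "f (x + y) = f x + f y" by (simp add: matrix_vector_right_distrib)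
lemma f_diff: "f (x - y) = f x - f y" by (simp add: matrix_vector_mult_diff_distrib)
lemma f_scaleR: "f (c *\<^sub>R x) = c *\<^sub>R f x" by (simp add: matrix_vector_mult_scaleR)
lemma f_minus: "f (- x) = - f x" using f_scaleR[of "- 1" x] by simp
lemmas f_simps = f_add f_diff f_scaleR f_minus

lemma w_add: "w (x + y) z = w x z + w y z" "w z (x + y) = w z x + w z y"
  by (simp_all add: sympw_def inner_add matrix_vector_right_distrib)
lemma w_diff: "w (x - y) z = w x z - w y z" "w z (x - y) = w z x - w z y"
  by (simp_all add: sympw_def inner_diff matrix_vector_mult_diff_distrib)
lemma w_scaleR: "w (c *\<^sub>R x) z = c * w x z" "w z (c *\<^sub>R x) = c * w z x"
  by (simp_all add: sympw_def matrix_vector_mult_scaleR)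
lemma w_zero: "w 0 z = 0" "w z 0 = 0"
  by (simp_all add: sympw_def)
lemma w_minus: "w (- x) z = - w x z" "w z (- x) = - w z x"
  using w_diff(1)[of 0 x z] w_diff(2)[of z 0 x] by (simp_all add: w_zero)
lemmas w_simps = w_add w_diff w_scaleR w_zero w_minus

lemma w_skew: "w x y = - w y x"
proof -
  have "w x y = (transpose Om *v x) \<bullet> y"
    by (simp add: sympw_def dot_lmul_matrix[symmetric])
  also have "\<dots> = - w y x"
    by (simp add: skew sympw_def inner_commute)
       (simp add: matrix_vector_mult_def sum_negf inner_vec_def)
  finally show ?thesis .
qed

lemma w_f: "w x (f y) = x \<bullet> (S *v y)"
  by (simp add: sympw_def matrix_vector_mul_assoc Om_L)

text \<open>\<open>L\<close> belongs to the symplectic Lie algebra, because \<open>S\<close> is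
  symmetric and \<open>w\<close> is skew. Consequently \<open>f\<close> applied twice is
  self-adjoint for \<open>w\<close>, which drives the orthogonality arguments below.\<close>

lemma w_f_left: "w (f x) y = - w x (f y)"
proof -
  have "w (f x) y = - (y \<bullet> (S *v x))" by (simp add: w_skew[of "f x"] w_f)
  also have "y \<bullet> (S *v x) = x \<bullet> (S *v y)"
    by (metis dot_lmul_matrix inner_commute symS vector_transpose_matrix)
  finally show ?thesis by (simp add: w_f)
qed

lemma w_nondegenerate:
  assumes "\<And>y. w x y = 0"
  shows "x = 0"
proof -
  have "w x (matrix_inv Om *v x) = x \<bullet> x"
    by (simp add: sympw_def matrix_vector_mul_assoc matrix_inv_mult Om_nondeg)
  then show ?thesis using assms by simp
qed

text \<open>The complement is the Euclidean orthogonal complement of the image of \<open>V\<close>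
  under the injective map \<open>Om\<close>.\<close>

lemma dim_symplectic_complement:
  assumes "subspace V"
  shows "dim {x. \<forall>y\<in>V. w x y = 0} = 4 - dim V"
proof -
  have lin: "linear ((*v) Om)" by simp
  have inj: "inj ((*v) Om)"
    using Om_nondeg by (metis invertible_def matrix_left_invertible_injective)
  have sub: "subspace ((*v) Om ` V)" using lin assms by (rule linear_subspace_image)
  have "{x. \<forall>y\<in>V. w x y = 0} = {x \<in> UNIV. \<forall>z\<in>(*v) Om ` V. orthogonal z x}"
    by (auto simp: sympw_def orthogonal_def inner_commute)
  then have "dim {x. \<forall>y\<in>V. w x y = 0} + dim ((*v) Om ` V) = 4"
    using dim_subspace_orthogonal_to_vectors[OF sub subspace_UNIV] by simp
  moreover have "dim ((*v) Om ` V) = dim V"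
    using lin inj by (intro dim_image_eq) (auto intro: inj_on_subset)
  ultimately show ?thesis by simp
qed

lemma subspace_symplectic_complement: "subspace {x. \<forall>y\<in>V. w x y = 0}"
  by (auto simp: subspace_def w_simps)

lemma dim_isotropic_le:
  assumes "subspace V" "\<And>x y. x \<in> V \<Longrightarrow> y \<in> V \<Longrightarrow> w x y = 0"
  shows "dim V \<le> 2"
proof -
  have "dim V \<le> dim {x. \<forall>y\<in>V. w x y = 0}"
    by (rule dim_subset) (use assms(2) in auto)
  then show ?thesis using dim_symplectic_complement[OF assms(1)] by linarith
qed

lemma lagr_in_cone_iff:
  "V \<in> lagr_in_cone Om S \<longleftrightarrow> subspace V \<and> dim V = 2 \<and> (\<forall>x\<in>V. \<forall>y\<in>V. w x y = 0) \<and> (\<forall>x\<in>V. f x \<in> V)"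
proof
  assume "V \<in> lagr_in_cone Om S"
  then have V: "subspace V" "dim V = 2" "\<forall>x\<in>V. \<forall>y\<in>V. w x y = 0" and cone: "V \<subseteq> null_cone S"
    by (auto simp: lagr_in_cone_def lagrangian_plane_def)
  \<comment> \<open>Isotropy gives the inclusion and both sides have dimension 2, so membership in
    \<open>V\<close> can be tested with \<open>w\<close>.\<close>
  have "V = {x. \<forall>y\<in>V. w x y = 0}"
    using V by (intro subspace_dim_equal subspace_symplectic_complement)
      (auto simp: dim_symplectic_complement)
  moreover have "w (f x) y = 0" if "x \<in> V" "y \<in> V" for x y
  proof -
    have "w z (f z) = 0" if "z \<in> V" for z
      using cone that by (auto simp: null_cone_def quadH_def w_f)
    then have "w x (f x) = 0" "w y (f y) = 0" "w (x + y) (f (x + y)) = 0"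
      using that subspace_add[OF V(1)] by auto
    then have "w x (f y) + w y (f x) = 0" by (simp add: w_simps f_simps)
    moreover have "w y (f x) = w x (f y)"
      using w_f_left[of x y] w_skew[of "f x" y] by simp
    ultimately show ?thesis by (simp add: w_f_left)
  qed
  ultimately show "subspace V \<and> dim V = 2 \<and> (\<forall>x\<in>V. \<forall>y\<in>V. w x y = 0) \<and> (\<forall>x\<in>V. f x \<in> V)"
    using V by blast
next
  assume "subspace V \<and> dim V = 2 \<and> (\<forall>x\<in>V. \<forall>y\<in>V. w x y = 0) \<and> (\<forall>x\<in>V. f x \<in> V)"
  then show "V \<in> lagr_in_cone Om S"
    by (auto simp: lagr_in_cone_def lagrangian_plane_def null_cone_def quadH_def w_f[symmetric])
qed

section \<open>Kernels of quadratic polynomials in L\<close>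

text \<open>If the quadratic has roots a and b, then k = -(a + b) and r = ab; negating
  \<open>k\<close> negates the roots. \<open>Q 0 (- s)\<close> is the kernel of L^2 - s.\<close>

definition Q :: "real \<Rightarrow> real \<Rightarrow> (real^4) set" where
  "Q k r = {x. f (f x) + k *\<^sub>R f x + r *\<^sub>R x = 0}"

lemma subspace_Q: "subspace (Q k r)"
  unfolding subspace_def Q_def
proof (intro conjI ballI allI; clarsimp simp: f_simps)
  fix x y
  assume "f (f x) + k *\<^sub>R f x + r *\<^sub>R x = 0" "f (f y) + k *\<^sub>R f y + r *\<^sub>R y = 0"
  then have "(f (f x) + k *\<^sub>R f x + r *\<^sub>R x) + (f (f y) + k *\<^sub>R f y + r *\<^sub>R y) = 0" by simp
  then show "f (f x) + f (f y) + k *\<^sub>R (f x + f y) + r *\<^sub>R (x + y) = 0"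
    by (simp add: algebra_simps)
next
  fix c x
  assume "f (f x) + k *\<^sub>R f x + r *\<^sub>R x = 0"
  then have "c *\<^sub>R (f (f x) + k *\<^sub>R f x + r *\<^sub>R x) = 0" by simp
  then show "c *\<^sub>R f (f x) + (k * c) *\<^sub>R f x + (r * c) *\<^sub>R x = 0"
    by (simp add: algebra_simps)
qed

lemma Q_f: "x \<in> Q k r \<Longrightarrow> f x \<in> Q k r"
proof -
  assume "x \<in> Q k r"
  then have "f (f (f x) + k *\<^sub>R f x + r *\<^sub>R x) = 0" by (simp add: Q_def)
  then show ?thesis by (simp add: Q_def f_simps)
qed

lemma Q_ff: "x \<in> Q k r \<Longrightarrow> f (f x) = (- k) *\<^sub>R f x - r *\<^sub>R x"
  by (simp add: Q_def algebra_simps eq_neg_iff_add_eq_0)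

text \<open>Applying \<open>f\<close> twice is self-adjoint for \<open>w\<close>; replacing it by
  -kf - r in both arguments leaves only the skew-adjoint term, so k w(fx, y) = 0. Using this also
  for \<open>f x\<close> in place of \<open>x\<close> gives r w(x, y) = 0.\<close>

lemma isotropic_Q:
  assumes "k \<noteq> 0" "r \<noteq> 0" "x \<in> Q k r" "y \<in> Q k r"
  shows "w x y = 0"
proof -
  have *: "w (f x) y = 0" if x: "x \<in> Q k r" for x
  proof -
    have "w (f (f x)) y = w x (f (f y))" by (simp add: w_f_left)
    then have "k * w (f x) y = 0"
      unfolding Q_ff[OF x] Q_ff[OF assms(4)] by (simp add: w_simps w_f_left)
    then show ?thesis using assms(1) by simp
  qed
  have "w (f (f x)) y = 0" using * Q_f assms(3) by blast
  then show ?thesis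
    unfolding Q_ff[OF assms(3)] using *[OF assms(3)] assms(2) by (simp add: w_simps)
qed

text \<open>\<open>CH\<close> says q(L) q(-L) = 0 for q = X^2 + kX + r. The two factors differ by
  2kX, so they are applied to the preimage \<open>u\<close> of \<open>v\<close> under
  \<open>L\<close> and their difference is 2k v.\<close>

lemma Q_split:
  assumes CH: "\<And>v. f (f (f (f v))) + (2 * r - k\<^sup>2) *\<^sub>R f (f v) + r\<^sup>2 *\<^sub>R v = 0"
    and "k \<noteq> 0" "r \<noteq> 0"
    and V: "subspace V" "\<forall>x\<in>V. f x \<in> V" and v: "v \<in> V"
  obtains x y where "v = x + y" "x \<in> V" "x \<in> Q k r" "y \<in> V" "y \<in> Q (- k) r"
proof -
  \<comment> \<open>The inverse of \<open>L\<close> at \<open>v\<close>, read off from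
    \<open>CH\<close> as a polynomial in \<open>L\<close>, hence an element of the invariant
    subspace \<open>V\<close>.\<close>
  define u where "u = (- 1 / r\<^sup>2) *\<^sub>R (f (f (f v)) + (2 * r - k\<^sup>2) *\<^sub>R f v)"
  have u: "u \<in> V" unfolding u_def using V v by (intro subspace_scale subspace_add) auto
  have "f u = (- 1 / r\<^sup>2) *\<^sub>R (f (f (f (f v))) + (2 * r - k\<^sup>2) *\<^sub>R f (f v))"
    by (simp add: u_def f_simps)
  also have "f (f (f (f v))) + (2 * r - k\<^sup>2) *\<^sub>R f (f v) = - (r\<^sup>2 *\<^sub>R v)"
    using CH[of v] by (simp add: eq_neg_iff_add_eq_0)
  finally have fu: "f u = v" using \<open>r \<noteq> 0\<close> by simp
  \<comment> \<open>Each factor maps \<open>u\<close> into the kernel of the other; \<open>l\<close>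
    stands for either \<open>k\<close> or \<open>- k\<close>.\<close>
  have mem: "c *\<^sub>R (f (f u) + l *\<^sub>R f u + r *\<^sub>R u) \<in> Q (- l) r" if "l\<^sup>2 = k\<^sup>2" for c l
  proof -
    have "f (f u) + l *\<^sub>R f u + r *\<^sub>R u \<in> Q (- l) r"
      using CH[of u] unfolding that[symmetric]
      by (simp add: Q_def f_simps vec_eq_iff algebra_simps power2_eq_square)
    then show ?thesis by (rule subspace_scale[OF subspace_Q])
  qed
  show thesis
  proof (rule that)
    show "v = (- 1 / (2 * k)) *\<^sub>R (f (f u) + (- k) *\<^sub>R f u + r *\<^sub>R u)
        + (1 / (2 * k)) *\<^sub>R (f (f u) + k *\<^sub>R f u + r *\<^sub>R u)"
      using \<open>k \<noteq> 0\<close> unfolding fu by (simp add: vec_eq_iff field_simps)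
    show "(- 1 / (2 * k)) *\<^sub>R (f (f u) + (- k) *\<^sub>R f u + r *\<^sub>R u) \<in> Q k r"
      using mem[of "- k" "- 1 / (2 * k)"] by simp
    show "(1 / (2 * k)) *\<^sub>R (f (f u) + k *\<^sub>R f u + r *\<^sub>R u) \<in> Q (- k) r"
      using mem[of k] by simp
    show "(- 1 / (2 * k)) *\<^sub>R (f (f u) + (- k) *\<^sub>R f u + r *\<^sub>R u) \<in> V"
      "(1 / (2 * k)) *\<^sub>R (f (f u) + k *\<^sub>R f u + r *\<^sub>R u) \<in> V"
      using V u by (intro subspace_scale subspace_add; simp)+
  qed
qed

lemma Q_lagrangian:
  assumes CH: "\<And>v. f (f (f (f v))) + (2 * r - k\<^sup>2) *\<^sub>R f (f v) + r\<^sup>2 *\<^sub>R v = 0"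
    and kr: "k \<noteq> 0" "r \<noteq> 0"
  shows "Q k r \<in> lagr_in_cone Om S"
proof -
  have le: "dim (Q l r) \<le> 2" if "l \<noteq> 0" for l
    by (rule dim_isotropic_le[OF subspace_Q]) (use isotropic_Q that kr in blast)
  have "v \<in> {x + y |x y. x \<in> Q k r \<and> y \<in> Q (- k) r}" for v
    using Q_split[OF CH kr subspace_UNIV, of v] by blast
  then have "{x + y |x y. x \<in> Q k r \<and> y \<in> Q (- k) r} = UNIV" by blast
  then have "4 \<le> dim (Q k r) + dim (Q (- k) r)"
    using dim_sums_Int[OF subspace_Q subspace_Q, of k r "- k" r] by simp
  then have "dim (Q k r) = 2" using le[of k] le[of "- k"] kr(1) by simp
  then show ?thesis
    unfolding lagr_in_cone_iff using subspace_Q Q_f isotropic_Q[OF kr] by blast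
qed

lemma Q_Int:
  assumes "k \<noteq> 0" "x \<in> Q k r" "x \<in> Q (- k) r"
  shows "x = 0"
proof -
  have "(- k) *\<^sub>R f x - r *\<^sub>R x = k *\<^sub>R f x - r *\<^sub>R x"
    using Q_ff[OF assms(2)] Q_ff[OF assms(3)] by simp
  then have "(2 * k) *\<^sub>R f x = 0" by (simp add: vec_eq_iff)
  then show ?thesis using assms(1) by (simp add: inj_L)
qed

lemma lagr_nonzero:
  assumes "V \<in> lagr_in_cone Om S"
  obtains v where "v \<in> V" "v \<noteq> 0"
proof -
  have "dim V = 2" using assms by (simp add: lagr_in_cone_iff)
  then have "\<not> V \<subseteq> {0}" using dim_eq_0[of V] by linarith
  then show thesis using that by blast
qed

lemma Q_neq:
  assumes "k \<noteq> 0" "Q k r \<in> lagr_in_cone Om S"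
  shows "Q k r \<noteq> Q (- k) r"
proof
  assume eq: "Q k r = Q (- k) r"
  obtain v where "v \<in> Q k r" "v \<noteq> 0" using assms(2) by (rule lagr_nonzero)
  then show False using Q_Int[OF assms(1), of v r] eq by simp
qed

lemma lagr_eqI:
  assumes "V \<in> lagr_in_cone Om S" "W \<in> lagr_in_cone Om S" "V \<subseteq> W"
  shows "V = W"
proof (rule subspace_dim_equal)
  show "subspace V" "subspace W" "dim W \<le> dim V" using assms(1,2) by (simp_all add: lagr_in_cone_iff)
qed (rule assms(3))

section \<open>Full quadruplet of eigenvalues\<close>

text \<open>By \<open>disc\<close> the two quadratic factors have no real roots, so neither kernel
  contains an eigenvector. A nonzero component of a vector of \<open>V\<close> in one kernel
  therefore spans, together with its image, both that kernel and \<open>V\<close>.\<close>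

lemma lagr_complex_quadruple:
  assumes CH: "\<And>v. f (f (f (f v))) + (2 * r - k\<^sup>2) *\<^sub>R f (f v) + r\<^sup>2 *\<^sub>R v = 0"
    and k: "k \<noteq> 0" and disc: "k\<^sup>2 < 4 * r"
  shows "card (lagr_in_cone Om S) = 2"
proof -
  have r: "r \<noteq> 0" using disc zero_le_power2[of k] by linarith
  have lagr: "Q l r \<in> lagr_in_cone Om S" if "l\<^sup>2 = k\<^sup>2" for l
  proof (rule Q_lagrangian)
    show "f (f (f (f v))) + (2 * r - l\<^sup>2) *\<^sub>R f (f v) + r\<^sup>2 *\<^sub>R v = 0" for v
      unfolding that by (rule CH)
  qed (use k r that in auto)
  have no_eigen: "f x \<noteq> c *\<^sub>R x" if "x \<in> Q l r" "x \<noteq> 0" "l\<^sup>2 = k\<^sup>2" for x c l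
  proof
    assume "f x = c *\<^sub>R x"
    then have "(c\<^sup>2 + l * c + r) *\<^sub>R x = 0"
      using that(1) by (simp add: Q_def f_simps power2_eq_square algebra_simps)
    then have "c\<^sup>2 + l * c + r = 0" using that(2) by simp
    \<comment> \<open>Completing the square: a real root \<open>c\<close> would make the
      discriminant a square.\<close>
    moreover have "4 * (c\<^sup>2 + l * c + r) + (l\<^sup>2 - 4 * r) = (2 * c + l)\<^sup>2"
      by (simp add: power2_eq_square algebra_simps)
    ultimately have "0 \<le> l\<^sup>2 - 4 * r" by (metis add_0 mult_zero_right zero_le_power2)
    then show False using disc that(3) by linarith
  qed
  have eq: "V = Q l r" if V: "V \<in> lagr_in_cone Om S" and z: "z \<in> V" "z \<in> Q l r" "z \<noteq> 0" "l\<^sup>2 = k\<^sup>2" for V l z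
  proof (rule plane_eqI[where x = z and y = "f z"])
    show "f z \<noteq> c *\<^sub>R z" for c using no_eigen z by blast
    show "z \<in> V \<inter> Q l r" "f z \<in> V \<inter> Q l r" using V z Q_f by (auto simp: lagr_in_cone_iff)
    show "dim (Q l r) = 2" using lagr z by (simp add: lagr_in_cone_iff)
  qed (use V z subspace_Q in \<open>auto simp: lagr_in_cone_iff\<close>)
  have "lagr_in_cone Om S = {Q k r, Q (- k) r}"
  proof (intro equalityI subsetI)
    fix V
    assume V: "V \<in> lagr_in_cone Om S"
    then obtain v where v: "v \<in> V" "v \<noteq> 0" by (rule lagr_nonzero)
    obtain x y where "v = x + y" "x \<in> V" "x \<in> Q k r" "y \<in> V" "y \<in> Q (- k) r"
      using Q_split[OF CH k r _ _ v(1)] V by (auto simp: lagr_in_cone_iff)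
    then show "V \<in> {Q k r, Q (- k) r}"
      using eq[OF V, of x k] eq[OF V, of y "- k"] v(2) by (cases "x = 0") auto
  qed (use lagr in auto)
  then show ?thesis using Q_neq[OF k lagr] by simp
qed

section \<open>Double eigenvalues with nilpotent part\<close>

lemma ker_lagrangian_if_square_zero:
  assumes CH: "\<And>v. f (f (f (f v))) - (2 * s) *\<^sub>R f (f v) + s\<^sup>2 *\<^sub>R v = 0"
    and x0: "f (f x0) \<noteq> s *\<^sub>R x0"
  shows "Q 0 (- s) \<in> lagr_in_cone Om S"
proof -
  define M where "M x = f (f x) - s *\<^sub>R x" for x
  have Q: "Q 0 (- s) = {x. M x = 0}" by (auto simp: Q_def M_def)
  have M_add: "M (x + y) = M x + M y" and M_scaleR: "M (c *\<^sub>R x) = c *\<^sub>R M x" for x y c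
    by (simp_all add: M_def f_simps algebra_simps)
  then have "linear M" by (intro linearI)
  then have range: "subspace (range M)" by (intro linear_subspace_image) auto
  have MM: "M (M x) = 0" for x
    using CH[of x] by (simp add: M_def f_simps vec_eq_iff algebra_simps power2_eq_square)
  have M_sym: "w (M x) y = w x (M y)" for x y
    by (simp add: M_def w_simps w_f_left)
  \<comment> \<open>\<open>w (M x) y\<close> is skew-symmetric in \<open>x\<close> and \<open>y\<close>, so its rank is even.\<close>
  have skewM: "w (M x) x = 0" for x
    using M_sym[of x x] w_skew[of x "M x"] by simp
  have "M x0 \<noteq> 0" using x0 by (simp add: M_def)
  then obtain y0 where y0: "w (M x0) y0 \<noteq> 0" using w_nondegenerate by blast
  have "2 \<le> dim (range M)"
  proof (rule two_le_dim)
    \<comment> \<open>\<open>skewM\<close> at \<open>y0\<close> forces \<open>c\<close> = 0, and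
      then M y0 = 0 contradicts the choice of \<open>y0\<close>.\<close>
    show "M y0 \<noteq> c *\<^sub>R M x0" for c
    proof
      assume "M y0 = c *\<^sub>R M x0"
      then have "c * w (M x0) y0 = 0" using skewM[of y0] by (simp add: w_simps)
      then have "M y0 = 0" using y0 \<open>M y0 = c *\<^sub>R M x0\<close> by simp
      then show False using y0 M_sym[of x0 y0] by (simp add: w_simps)
    qed
  qed (use \<open>M x0 \<noteq> 0\<close> in auto)
  moreover have "dim (range M) \<le> 2"
    by (rule dim_isotropic_le[OF range]) (auto simp: M_sym MM w_simps)
  ultimately have dim: "dim (range M) = 2" by simp
  \<comment> \<open>Self-adjointness puts the kernel of \<open>M\<close> into the complement of its
    image, which has dimension 2; as the image lies in the kernel, the two agree.\<close>
  have "Q 0 (- s) \<subseteq> {x. \<forall>y\<in>range M. w x y = 0}"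
    by (auto simp: Q M_sym[symmetric] w_simps)
  then have "dim (Q 0 (- s)) \<le> dim {x. \<forall>y\<in>range M. w x y = 0}" by (rule dim_subset)
  then have "dim (Q 0 (- s)) \<le> 2" unfolding dim_symplectic_complement[OF range] dim by simp
  then have eq: "range M = Q 0 (- s)"
    by (intro subspace_dim_equal[OF range subspace_Q]) (auto simp: Q MM dim)
  have "\<forall>x\<in>range M. \<forall>y\<in>range M. w x y = 0" by (auto simp: M_sym MM w_simps)
  then show ?thesis
    unfolding lagr_in_cone_iff eq using subspace_Q Q_f dim[unfolded eq] by blast
qed

text \<open>Since L^2 - s squares to zero, its kernel contains \<open>v\<close> or the nonzero image
  of \<open>v\<close>. As \<open>s\<close> is negative, a nonzero \<open>z\<close> in this kernel is
  not an eigenvector, so \<open>z\<close> and \<open>f z\<close> determine the plane.\<close>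

lemma lagr_imaginary_double:
  assumes CH: "\<And>v. f (f (f (f v))) - (2 * s) *\<^sub>R f (f v) + s\<^sup>2 *\<^sub>R v = 0"
    and x0: "f (f x0) \<noteq> s *\<^sub>R x0" and s: "s < 0"
  shows "card (lagr_in_cone Om S) = 1"
proof -
  have lagr: "Q 0 (- s) \<in> lagr_in_cone Om S" using CH x0 by (rule ker_lagrangian_if_square_zero)
  have "V = Q 0 (- s)" if V: "V \<in> lagr_in_cone Om S" for V
  proof -
    obtain v where v: "v \<in> V" "v \<noteq> 0" using V by (rule lagr_nonzero)
    have inv: "f x \<in> V" if "x \<in> V" for x using V that by (simp add: lagr_in_cone_iff)
    obtain z where z: "z \<in> V" "z \<noteq> 0" "f (f z) = s *\<^sub>R z"
    proof (cases "f (f v) = s *\<^sub>R v")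
      case True
      then show ?thesis using that v by blast
    next
      case False
      moreover have "f (f v) - s *\<^sub>R v \<in> V"
        using V v inv by (auto simp: lagr_in_cone_iff intro!: subspace_diff subspace_scale)
      moreover have "f (f (f (f v) - s *\<^sub>R v)) = s *\<^sub>R (f (f v) - s *\<^sub>R v)"
        using CH[of v] by (simp add: f_simps vec_eq_iff algebra_simps power2_eq_square)
      ultimately show ?thesis using that by auto
    qed
    show ?thesis
    proof (rule plane_eqI[where x = z and y = "f z"])
      show "f z \<noteq> c *\<^sub>R z" for c
      proof
        assume "f z = c *\<^sub>R z"
        then have "(c * c) *\<^sub>R z = s *\<^sub>R z" using z(3) by (simp add: f_simps)
        then have "c * c = s" using z(2) by simp
        then show False using s zero_le_square[of c] by linarith
      qed
      show "z \<in> V \<inter> Q 0 (- s)" "f z \<in> V \<inter> Q 0 (- s)"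
        using z inv by (auto simp: Q_def f_simps)
    qed (use V z lagr in \<open>auto simp: lagr_in_cone_iff\<close>)
  qed
  with lagr have "lagr_in_cone Om S = {Q 0 (- s)}" by blast
  then show ?thesis by simp
qed

text \<open>The three planes are the two generalized eigenspaces, where
  \<open>Q (2 * c) (l\<^sup>2)\<close> is the kernel of (L + c)^2, and the kernel of L^2 - l^2,
  which contains the eigenvectors of both signs.\<close>

lemma lagr_real_double:
  assumes CH: "\<And>v. f (f (f (f v))) - (2 * l\<^sup>2) *\<^sub>R f (f v) + (l\<^sup>2)\<^sup>2 *\<^sub>R v = 0"
    and x0: "f (f x0) \<noteq> l\<^sup>2 *\<^sub>R x0" and l: "l \<noteq> 0"
  shows "card (lagr_in_cone Om S) = 3"
proof -
  have lagr0: "Q 0 (- l\<^sup>2) \<in> lagr_in_cone Om S" using CH x0 by (rule ker_lagrangian_if_square_zero)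
  have CH': "f (f (f (f v))) + (2 * l\<^sup>2 - (2 * c)\<^sup>2) *\<^sub>R f (f v) + (l\<^sup>2)\<^sup>2 *\<^sub>R v = 0" if "c\<^sup>2 = l\<^sup>2" for v c
    using CH[of v] that by (simp add: power_mult_distrib scaleR_diff_left algebra_simps)
  have lagr: "Q (2 * c) (l\<^sup>2) \<in> lagr_in_cone Om S" if "c\<^sup>2 = l\<^sup>2" for c
    by (rule Q_lagrangian) (use CH' l that in auto)
  \<comment> \<open>If they were equal, L^2 - l^2 would map the opposite generalized eigenspace into
    itself and into this one, hence to 0. That space would then lie in both and be trivial, although
    it is Lagrangian.\<close>
  have Q0_neq: "Q 0 (- l\<^sup>2) \<noteq> Q (2 * c) (l\<^sup>2)" if c: "c\<^sup>2 = l\<^sup>2" for c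
  proof
    assume eq: "Q 0 (- l\<^sup>2) = Q (2 * c) (l\<^sup>2)"
    have "c \<noteq> 0" using c l by auto
    have "x = 0" if x: "x \<in> Q (- (2 * c)) (l\<^sup>2)" for x
    proof -
      have "f (f x) - l\<^sup>2 *\<^sub>R x \<in> Q (- (2 * c)) (l\<^sup>2)"
        using x Q_f by (intro subspace_diff subspace_scale subspace_Q) auto
      moreover have "f (f x) - l\<^sup>2 *\<^sub>R x \<in> Q 0 (- l\<^sup>2)"
        using CH[of x] by (simp add: Q_def f_simps vec_eq_iff algebra_simps power2_eq_square)
      ultimately have "f (f x) - l\<^sup>2 *\<^sub>R x = 0"
        unfolding eq using \<open>c \<noteq> 0\<close> by (intro Q_Int[of "2 * c"]) auto
      then have "x \<in> Q 0 (- l\<^sup>2)" by (simp add: Q_def)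
      then show ?thesis unfolding eq using \<open>c \<noteq> 0\<close> x by (intro Q_Int[of "2 * c"]) auto
    qed
    then show False using lagr_nonzero[OF lagr[of "- c"]] c by auto
  qed
  \<comment> \<open>The vector \<open>e\<close> = (L + c)x satisfies L e = -c e. If it is nonzero,
    \<open>e\<close> and \<open>x\<close> span both \<open>V\<close> and the generalized eigenspace,
    which is excluded; so \<open>x\<close> itself is killed by L + c.\<close>
  have ker: "x \<in> Q 0 (- l\<^sup>2)"
    if V: "V \<in> lagr_in_cone Om S" and neq: "V \<noteq> Q (2 * c) (l\<^sup>2)"
      and x: "x \<in> V" "x \<in> Q (2 * c) (l\<^sup>2)" and c: "c\<^sup>2 = l\<^sup>2" for V x c
  proof -
    define e where "e = f x + c *\<^sub>R x"
    have "f (f x) + (2 * c) *\<^sub>R f x + l\<^sup>2 *\<^sub>R x = 0" using x(2) by (simp add: Q_def)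
    then have "f e + c *\<^sub>R e = 0"
      unfolding c[symmetric] by (simp add: e_def f_simps vec_eq_iff algebra_simps power2_eq_square)
    then have fe: "f e = (- c) *\<^sub>R e" by (simp add: eq_neg_iff_add_eq_0)
    have "e = 0"
    proof (rule ccontr)
      assume "e \<noteq> 0"
      have "V = Q (2 * c) (l\<^sup>2)"
      proof (rule plane_eqI[where x = e and y = x])
        show "x \<noteq> d *\<^sub>R e" for d
        proof
          assume "x = d *\<^sub>R e"
          then have "f x = (- c) *\<^sub>R x" using fe by (simp add: f_simps)
          then show False using \<open>e \<noteq> 0\<close> by (simp add: e_def)
        qed
        show "e \<in> V \<inter> Q (2 * c) (l\<^sup>2)" unfolding e_def
          using V x lagr[OF c] by (auto simp: lagr_in_cone_iff intro!: subspace_add subspace_scale)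
      qed (use V x lagr[OF c] \<open>e \<noteq> 0\<close> in \<open>auto simp: lagr_in_cone_iff\<close>)
      with neq show False by simp
    qed
    then have "f x = (- c) *\<^sub>R x" by (simp add: e_def eq_neg_iff_add_eq_0)
    then show ?thesis using c by (simp add: Q_def f_simps power2_eq_square)
  qed
  have "lagr_in_cone Om S = {Q (2 * l) (l\<^sup>2), Q (- (2 * l)) (l\<^sup>2), Q 0 (- l\<^sup>2)}"
  proof (intro equalityI subsetI)
    fix V
    assume V: "V \<in> lagr_in_cone Om S"
    show "V \<in> {Q (2 * l) (l\<^sup>2), Q (- (2 * l)) (l\<^sup>2), Q 0 (- l\<^sup>2)}"
    proof (rule ccontr)
      assume nin: "V \<notin> {Q (2 * l) (l\<^sup>2), Q (- (2 * l)) (l\<^sup>2), Q 0 (- l\<^sup>2)}"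
      have "V \<subseteq> Q 0 (- l\<^sup>2)"
      proof
        fix v
        assume "v \<in> V"
        then obtain x y where xy: "v = x + y" "x \<in> V" "x \<in> Q (2 * l) (l\<^sup>2)" "y \<in> V" "y \<in> Q (- (2 * l)) (l\<^sup>2)"
          using Q_split[OF CH'[of l], of V v] V l by (auto simp: lagr_in_cone_iff)
        then show "v \<in> Q 0 (- l\<^sup>2)"
          using ker[OF V, of l x] ker[OF V, of "- l" y] nin by (auto intro: subspace_add[OF subspace_Q])
      qed
      then show False using lagr_eqI[OF V lagr0] nin by simp
    qed
  qed (use lagr0 lagr[of l] lagr[of "- l"] in auto)
  moreover have "Q (2 * l) (l\<^sup>2) \<noteq> Q (- (2 * l)) (l\<^sup>2)" using Q_neq lagr[of l] l by simp
  ultimately show ?thesis using Q0_neq[of l] Q0_neq[of "- l"] by simp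
qed

section \<open>Simple imaginary eigenvalues\<close>

lemma lagr_imaginary_simple:
  assumes CH: "\<And>v. f (f (f (f v))) + (p + q) *\<^sub>R f (f v) + (p * q) *\<^sub>R v = 0"
    and pq: "0 < p" "0 < q" "p \<noteq> q"
    and x0: "x0 \<noteq> 0" "x0 \<in> Q 0 p" and y0: "y0 \<noteq> 0" "y0 \<in> Q 0 q"
  shows "lagr_in_cone Om S = {}"
proof -
  have split: "\<exists>x y. v = x + y \<and> x \<in> V \<and> x \<in> Q 0 p \<and> y \<in> V \<and> y \<in> Q 0 q"
    if V: "subspace V" "\<And>x. x \<in> V \<Longrightarrow> f x \<in> V" "v \<in> V" for v V
  proof (intro exI conjI)
    \<comment> \<open>X^2 + q and X^2 + p differ by the constant q - p, which normalises the two
      projections.\<close>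
    let ?x = "(1 / (q - p)) *\<^sub>R (f (f v) + q *\<^sub>R v)" and ?y = "(1 / (p - q)) *\<^sub>R (f (f v) + p *\<^sub>R v)"
    show "v = ?x + ?y" using pq by (simp add: vec_eq_iff divide_simps) (simp add: algebra_simps)
    show "?x \<in> V" "?y \<in> V" using V by (auto intro!: subspace_scale subspace_add)
    have "f (f v) + q *\<^sub>R v \<in> Q 0 p" "f (f v) + p *\<^sub>R v \<in> Q 0 q"
      using CH[of v] by (simp_all add: Q_def f_simps vec_eq_iff algebra_simps)
    then show "?x \<in> Q 0 p" "?y \<in> Q 0 q" by (auto intro: subspace_scale[OF subspace_Q])
  qed
  \<comment> \<open>Eigenspaces of the self-adjoint L^2 for the distinct values -p and -q are
    orthogonal for \<open>w\<close>.\<close>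
  have orth: "w x y = 0" if "x \<in> Q 0 p" "y \<in> Q 0 q" for x y
  proof -
    have "w (f (f x)) y = w x (f (f y))" by (simp add: w_f_left)
    then have "(p - q) * w x y = 0"
      unfolding Q_ff[OF that(1)] Q_ff[OF that(2)] by (simp add: w_simps algebra_simps)
    then show ?thesis using pq by simp
  qed
  have no_eigen: "f x \<noteq> c *\<^sub>R x" if "x \<in> Q 0 r" "x \<noteq> 0" "0 < r" for x c r
  proof
    assume "f x = c *\<^sub>R x"
    then have "(c * c + r) *\<^sub>R x = 0" using that(1) by (simp add: Q_def f_simps algebra_simps)
    then have "c * c + r = 0" using that(2) by simp
    then show False using that(3) zero_le_square[of c] by linarith
  qed
  have ge: "2 \<le> dim (Q 0 p)" "2 \<le> dim (Q 0 q)"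
    using two_le_dim[of x0 "Q 0 p" "f x0"] two_le_dim[of y0 "Q 0 q" "f y0"]
      no_eigen x0 y0 Q_f pq by auto
  have "x = 0" if "x \<in> Q 0 p" "x \<in> Q 0 q" for x
  proof -
    have "(p - q) *\<^sub>R x = 0"
      using Q_ff[OF that(1)] Q_ff[OF that(2)] by (auto simp: scaleR_diff_left)
    then show ?thesis using pq by simp
  qed
  then have "Q 0 p \<inter> Q 0 q = {0}" using subspace_0[OF subspace_Q] by blast
  moreover have "v \<in> {x + y |x y. x \<in> Q 0 p \<and> y \<in> Q 0 q}" for v
    using split[OF subspace_UNIV, of v] by blast
  then have "{x + y |x y. x \<in> Q 0 p \<and> y \<in> Q 0 q} = UNIV" by blast
  ultimately have "dim (Q 0 p) + dim (Q 0 q) = 4"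
    using dim_sums_Int[OF subspace_Q subspace_Q, of 0 p 0 q] by simp
  with ge have dim: "dim (Q 0 p) = 2" "dim (Q 0 q) = 2" by linarith+
  show ?thesis
  proof (rule ccontr)
    assume "lagr_in_cone Om S \<noteq> {}"
    then obtain V where V: "V \<in> lagr_in_cone Om S" by blast
    then obtain v where v: "v \<in> V" "v \<noteq> 0" by (rule lagr_nonzero)
    obtain x y where xy: "v = x + y" "x \<in> V" "x \<in> Q 0 p" "y \<in> V" "y \<in> Q 0 q"
      using split[of V v] V v by (auto simp: lagr_in_cone_iff)
    have eq: "V = Q 0 r" if "z \<in> V" "z \<in> Q 0 r" "z \<noteq> 0" "0 < r" "dim (Q 0 r) = 2" for z r
      by (rule plane_eqI[where x = z and y = "f z"])
        (use that V Q_f subspace_Q no_eigen in \<open>auto simp: lagr_in_cone_iff\<close>)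
    have iso: "\<forall>x\<in>V. \<forall>y\<in>V. w x y = 0" using V by (simp add: lagr_in_cone_iff)
    have decomp: "\<exists>a b. u = a + b \<and> a \<in> Q 0 p \<and> b \<in> Q 0 q" for u
      using split[OF subspace_UNIV, of u] by blast
    \<comment> \<open>Otherwise \<open>V\<close> is the eigenplane of \<open>p\<close>, isotropic
      and orthogonal to the other eigenplane, which puts \<open>x\<close> into the radical of
      \<open>w\<close>.\<close>
    have "x = 0"
    proof (rule ccontr)
      assume "x \<noteq> 0"
      then have "V = Q 0 p" using eq xy pq dim by blast
      then have "w x u = 0" for u using decomp[of u] iso orth xy by (auto simp: w_simps)
      then show False using \<open>x \<noteq> 0\<close> w_nondegenerate by blast
    qed
    moreover have "y = 0"
    proof (rule ccontr)
      assume "y \<noteq> 0"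
      then have "V = Q 0 q" using eq xy pq dim by blast
      then have "w u y = 0" for u using decomp[of u] iso orth xy by (auto simp: w_simps)
      then have "w y u = 0" for u using w_skew[of y u] by simp
      then show False using \<open>y \<noteq> 0\<close> w_nondegenerate by blast
    qed
    ultimately show False using xy v by simp
  qed
qed

section \<open>Simple real eigenvalues\<close>

lemma w_eigenvectors:
  assumes "f x = a *\<^sub>R x" "f y = b *\<^sub>R y" "a + b \<noteq> 0"
  shows "w x y = 0"
proof -
  have "(a + b) * w x y = 0"
    using w_f_left[of x y] assms(1,2) by (simp add: w_simps algebra_simps)
  then show ?thesis using assms(3) by simp
qed

text \<open>On an eigenvector for \<open>c\<close> the quadratic acts as the scalar (c - a)(c - b).
  This later tells the four planes apart.\<close>

lemma eigenvector_in_Q_iff: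
  assumes "f x = c *\<^sub>R x" "x \<noteq> 0"
  shows "x \<in> Q (- (a + b)) (a * b) \<longleftrightarrow> c = a \<or> c = b"
proof -
  have "f (f x) + (- (a + b)) *\<^sub>R f x + (a * b) *\<^sub>R x = ((c - a) * (c - b)) *\<^sub>R x"
    using assms(1) by (simp add: f_simps algebra_simps)
  then show ?thesis using assms(2) by (simp add: Q_def)
qed

context
  fixes a b :: real
  assumes CH: "\<And>v. f (f (f (f v))) - (a\<^sup>2 + b\<^sup>2) *\<^sub>R f (f v) + (a\<^sup>2 * b\<^sup>2) *\<^sub>R v = 0"
    and ab: "a \<noteq> 0" "b \<noteq> 0" "a\<^sup>2 \<noteq> b\<^sup>2"
    and eigen: "\<And>c. c\<^sup>2 \<in> {a\<^sup>2, b\<^sup>2} \<Longrightarrow> \<exists>x. x \<noteq> 0 \<and> f x = c *\<^sub>R x"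
begin

text \<open>Each choice of signs groups the four linear factors as (X - s)(X - t) times (X + s)(X +
  t), the form that \<open>Q_split\<close> expects.\<close>

lemma CH_Q:
  assumes "s\<^sup>2 = a\<^sup>2" "t\<^sup>2 = b\<^sup>2"
  shows "f (f (f (f v))) + (2 * (s * t) - (- (s + t))\<^sup>2) *\<^sub>R f (f v) + (s * t)\<^sup>2 *\<^sub>R v = 0"
proof -
  have eqs: "2 * (s * t) - (- (s + t))\<^sup>2 = - (a\<^sup>2 + b\<^sup>2)" "(s * t)\<^sup>2 = a\<^sup>2 * b\<^sup>2"
    using assms by (simp_all add: power2_eq_square algebra_simps)
  show ?thesis unfolding eqs using CH[of v] by (simp add: vec_eq_iff algebra_simps)
qed

lemma Q_signs_lagrangian:
  assumes "s\<^sup>2 = a\<^sup>2" "t\<^sup>2 = b\<^sup>2"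
  shows "Q (- (s + t)) (s * t) \<in> lagr_in_cone Om S"
proof (rule Q_lagrangian)
  show "- (s + t) \<noteq> 0" using assms ab by (auto simp: add_eq_0_iff2)
  show "s * t \<noteq> 0" using assms ab by auto
qed (rule CH_Q[OF assms])

text \<open>\<open>Q_split\<close> comes first; then each part is split by two linear factors whose
  difference is a nonzero constant. All components stay in \<open>V\<close> by invariance.\<close>

lemma eigenvector_split:
  assumes V: "subspace V" "\<forall>x\<in>V. f x \<in> V" "v \<in> V"
    and st: "s\<^sup>2 = a\<^sup>2" "t\<^sup>2 = b\<^sup>2"
  obtains x y z u where "v = x + y + (z + u)" "x \<in> V" "y \<in> V" "z \<in> V" "u \<in> V"
    "f x = s *\<^sub>R x" "f y = t *\<^sub>R y" "f z = (- s) *\<^sub>R z" "f u = (- t) *\<^sub>R u"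
proof -
  have ne: "- (s + t) \<noteq> 0" "s * t \<noteq> 0" "s \<noteq> t" using st ab by (auto simp: add_eq_0_iff2)
  have split: "\<exists>x y. v = x + y \<and> x \<in> V \<and> y \<in> V \<and> f x = c *\<^sub>R x \<and> f y = d *\<^sub>R y"
    if v: "v \<in> V" "v \<in> Q (- (c + d)) (c * d)" and "c \<noteq> d" for v c d
  proof (intro exI conjI)
    let ?x = "(1 / (c - d)) *\<^sub>R (f v - d *\<^sub>R v)" and ?y = "(1 / (d - c)) *\<^sub>R (f v - c *\<^sub>R v)"
    show "v = ?x + ?y" using \<open>c \<noteq> d\<close> by (simp add: vec_eq_iff divide_simps) (simp add: algebra_simps)
    show "?x \<in> V" "?y \<in> V" using V v by (auto intro!: subspace_scale subspace_diff)
    have "f (f v - d *\<^sub>R v) = c *\<^sub>R (f v - d *\<^sub>R v)" "f (f v - c *\<^sub>R v) = d *\<^sub>R (f v - c *\<^sub>R v)"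
      using Q_ff[OF v(2)] by (simp_all add: f_simps vec_eq_iff algebra_simps)
    then show "f ?x = c *\<^sub>R ?x" "f ?y = d *\<^sub>R ?y" by (simp_all only: f_scaleR) simp_all
  qed
  obtain v1 v2 where v12: "v = v1 + v2" "v1 \<in> V" "v1 \<in> Q (- (s + t)) (s * t)"
    "v2 \<in> V" "v2 \<in> Q (- (- (s + t))) (s * t)"
    using Q_split[OF CH_Q[OF st] ne(1,2) V] by blast
  then have "v2 \<in> Q (- (- s + - t)) (- s * - t)" by simp
  with v12 show thesis
    using split[of v1 s t] split[of v2 "- s" "- t"] ne(3) that by (metis neg_equal_iff_equal)
qed

text \<open>If \<open>w x y\<close> were 0, \<open>x\<close> would be orthogonal to the plane
  spanned by \<open>y\<close> and an eigenvector for \<open>- t\<close>, and also to the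
  complementary Lagrangian plane containing \<open>x\<close>, contradicting nondegeneracy. The
  disjunction lets \<open>s\<close> come from either pair.\<close>

lemma w_opposite_eigenvectors:
  assumes st: "(s\<^sup>2 = a\<^sup>2 \<and> t\<^sup>2 = b\<^sup>2) \<or> (s\<^sup>2 = b\<^sup>2 \<and> t\<^sup>2 = a\<^sup>2)"
    and x: "x \<noteq> 0" "f x = s *\<^sub>R x" and y: "y \<noteq> 0" "f y = (- s) *\<^sub>R y"
  shows "w x y \<noteq> 0"
proof
  assume xy: "w x y = 0"
  have ne: "s \<noteq> 0" "t \<noteq> 0" "s \<noteq> t" "s + t \<noteq> 0"
    using st ab by (auto simp: add_eq_0_iff2)
  \<comment> \<open>\<open>c\<close> = 1 and \<open>c\<close> = -1 give the two complementary
    planes.\<close>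
  have lagr: "Q (- (c * (s + t))) (s * t) \<in> lagr_in_cone Om S" if "c\<^sup>2 = 1" for c
  proof -
    have "Q (- (c * s + c * t)) ((c * s) * (c * t)) \<in> lagr_in_cone Om S"
      using st Q_signs_lagrangian[of "c * s" "c * t"] Q_signs_lagrangian[of "c * t" "c * s"] that
      by (metis add.commute mult.commute mult_1 power_mult_distrib)
    moreover have "(c * s) * (c * t) = s * t"
      using that by (simp add: power2_eq_square mult.left_commute flip: mult.assoc)
    ultimately show ?thesis by (simp only: distrib_left)
  qed
  obtain z where z: "z \<noteq> 0" "f z = (- t) *\<^sub>R z" using eigen[of "- t"] st by auto
  have xz: "w x z = 0" using w_eigenvectors[OF x(2) z(2)] ne by simp
  \<comment> \<open>\<open>y\<close> and \<open>z\<close> are independent elements of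
    \<open>?U\<close>, so \<open>?U\<close> exhausts the Lagrangian plane.\<close>
  let ?U = "{u \<in> Q (s + t) (s * t). w x u = 0}"
  have sub: "subspace ?U"
    using subspace_Q[of "s + t" "s * t"] by (auto simp: subspace_def w_simps)
  have "y \<in> Q (s + t) (s * t)" "z \<in> Q (s + t) (s * t)"
    using eigenvector_in_Q_iff[OF y(2,1), of "- s" "- t"] eigenvector_in_Q_iff[OF z(2,1), of "- s" "- t"]
    by (simp_all add: add.commute)
  then have "2 \<le> dim ?U"
  proof (intro two_le_dim[of y _ z])
    show "z \<noteq> c *\<^sub>R y" for c
    proof
      assume "z = c *\<^sub>R y"
      then have "f z = (- s) *\<^sub>R z" using y by (simp add: f_simps)
      then have "s *\<^sub>R z = t *\<^sub>R z" using z(2) by auto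
      then show False using z(1) ne(3) by simp
    qed
  qed (use xy xz y in auto)
  then have "?U = Q (s + t) (s * t)"
    using lagr[of "- 1"] by (intro subspace_dim_equal[OF sub subspace_Q]) (auto simp: lagr_in_cone_iff add.commute)
  then have minus: "w x u = 0" if "u \<in> Q (s + t) (s * t)" for u using that by blast
  have "x \<in> Q (- (s + t)) (s * t)" using eigenvector_in_Q_iff[OF x(2,1)] by simp
  then have plus: "w x u = 0" if "u \<in> Q (- (s + t)) (s * t)" for u
    using lagr[of 1] that by (simp add: lagr_in_cone_iff)
  have CH_st: "f (f (f (f v))) + (2 * (s * t) - (- (s + t))\<^sup>2) *\<^sub>R f (f v) + (s * t)\<^sup>2 *\<^sub>R v = 0" for v
    using st CH_Q[of s t v] CH_Q[of t s v] by (auto simp: add.commute mult.commute)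
  have "w x u = 0" for u
  proof -
    obtain u1 u2 where "u = u1 + u2" "u1 \<in> Q (- (s + t)) (s * t)" "u2 \<in> Q (- (- (s + t))) (s * t)"
      using Q_split[OF CH_st _ _ subspace_UNIV, of u] ne by auto
    then show ?thesis using plus minus by (simp add: w_simps add.commute)
  qed
  then show False using x(1) w_nondegenerate by blast
qed

text \<open>An isotropic \<open>V\<close> cannot contain eigenvectors for both \<open>c\<close> and
  \<open>- c\<close>. Hence one sign of each of \<open>a\<close> and \<open>b\<close> is missing,
  which confines \<open>V\<close> to one of four planes.\<close>

lemma lagr_real_simple: "card (lagr_in_cone Om S) = 4"
proof -
  let ?P = "\<lambda>s t. Q (- (s + t)) (s * t)"
  have sub: "V = ?P s t"
    if V: "V \<in> lagr_in_cone Om S" and st: "s\<^sup>2 = a\<^sup>2" "t\<^sup>2 = b\<^sup>2"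
      and s: "\<And>x. x \<in> V \<Longrightarrow> f x = (- s) *\<^sub>R x \<Longrightarrow> x = 0"
      and t: "\<And>x. x \<in> V \<Longrightarrow> f x = (- t) *\<^sub>R x \<Longrightarrow> x = 0" for V s t
  proof (rule lagr_eqI[OF V Q_signs_lagrangian[OF st]], rule subsetI)
    fix v
    assume "v \<in> V"
    moreover have "subspace V" "\<forall>x\<in>V. f x \<in> V" using V by (auto simp: lagr_in_cone_iff)
    ultimately obtain x y z u where v: "v = x + y + (z + u)" "x \<in> V" "y \<in> V" "z \<in> V" "u \<in> V"
      "f x = s *\<^sub>R x" "f y = t *\<^sub>R y" "f z = (- s) *\<^sub>R z" "f u = (- t) *\<^sub>R u"
      using eigenvector_split[OF _ _ _ st] by metis
    have "x \<in> ?P s t" "y \<in> ?P s t" using v(6,7) by (simp_all add: Q_def f_simps algebra_simps)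
    moreover have "z = 0" "u = 0" using s t v by blast+
    ultimately show "v \<in> ?P s t" using v(1) by (simp add: subspace_add[OF subspace_Q])
  qed
  have sign: "\<exists>s. (s = c \<or> s = - c) \<and> (\<forall>x\<in>V. f x = (- s) *\<^sub>R x \<longrightarrow> x = 0)"
    if V: "V \<in> lagr_in_cone Om S" and c: "c = a \<or> c = b" for V c
  proof (rule ccontr)
    assume "\<not> ?thesis"
    then obtain x y where xy: "x \<in> V" "y \<in> V" "x \<noteq> 0" "y \<noteq> 0" "f x = c *\<^sub>R x" "f y = (- c) *\<^sub>R y"
      by (metis minus_minus)
    have "a \<noteq> b" using ab by auto
    \<comment> \<open>The conditional names the partner of \<open>c\<close> among \<open>a\<close>
      and \<open>b\<close>.\<close>
    then have "w x y \<noteq> 0"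
      using w_opposite_eigenvectors[of c "if c = a then b else a" x y] xy c by auto
    then show False using V xy by (simp add: lagr_in_cone_iff)
  qed
  have "lagr_in_cone Om S = {?P a b, ?P a (- b), ?P (- a) b, ?P (- a) (- b)}"
  proof (intro equalityI subsetI)
    fix V
    assume V: "V \<in> lagr_in_cone Om S"
    obtain s t where s: "s = a \<or> s = - a" "\<forall>x\<in>V. f x = (- s) *\<^sub>R x \<longrightarrow> x = 0"
      and t: "t = b \<or> t = - b" "\<forall>x\<in>V. f x = (- t) *\<^sub>R x \<longrightarrow> x = 0"
      using sign[OF V, of a] sign[OF V, of b] by blast
    have "V = ?P s t" using s t by (intro sub[OF V]) auto
    then show "V \<in> {?P a b, ?P a (- b), ?P (- a) b, ?P (- a) (- b)}" using s(1) t(1) by blast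
  next
    fix V
    assume "V \<in> {?P a b, ?P a (- b), ?P (- a) b, ?P (- a) (- b)}"
    then show "V \<in> lagr_in_cone Om S"
      using Q_signs_lagrangian[of a b] Q_signs_lagrangian[of a "- b"]
        Q_signs_lagrangian[of "- a" b] Q_signs_lagrangian[of "- a" "- b"] by auto
  qed
  moreover have neq: "?P s t \<noteq> ?P s' t'"
    if st: "s\<^sup>2 = a\<^sup>2" "t\<^sup>2 = b\<^sup>2" "s'\<^sup>2 = a\<^sup>2" "t'\<^sup>2 = b\<^sup>2" "s \<noteq> s' \<or> t \<noteq> t'" for s t s' t'
  proof -
    \<comment> \<open>An eigenvalue of the first plane that is missing from the second; its
      eigenvector separates the planes.\<close>
    obtain c where c: "c\<^sup>2 \<in> {a\<^sup>2, b\<^sup>2}" "c \<noteq> s' \<and> c \<noteq> t' \<and> (c = s \<or> c = t)"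
    proof (rule that)
      have "s \<noteq> t'" "t \<noteq> s'" using st ab by auto
      then show "(if s = s' then t else s) \<noteq> s' \<and> (if s = s' then t else s) \<noteq> t'
          \<and> ((if s = s' then t else s) = s \<or> (if s = s' then t else s) = t)"
        using st by auto
    qed (use st in auto)
    then obtain x where x: "x \<noteq> 0" "f x = c *\<^sub>R x" using eigen by blast
    then show ?thesis
      using eigenvector_in_Q_iff[OF x(2,1), of s t] eigenvector_in_Q_iff[OF x(2,1), of s' t'] c by metis
  qed
  moreover have "distinct [?P a b, ?P a (- b), ?P (- a) b, ?P (- a) (- b)]"
    using ab neq[of a b a "- b"] neq[of a b "- a" b] neq[of a b "- a" "- b"] neq[of a "- b" "- a" b]
      neq[of a "- b" "- a" "- b"] neq[of "- a" b "- a" "- b"]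
    unfolding distinct.simps by auto
  ultimately show ?thesis using distinct_card by fastforce
qed

end

end

section \<open>Reading off the biquadratic relation in each of the five cases\<close>

theorem theorem1:
  fixes Om S :: "real^4^4"
  assumes skew: "transpose Om = - Om" and Om_nondeg: "invertible Om"
    and symS: "transpose S = S" and S_nondeg: "invertible S"
    and sig0: "n_pos_eig S = 2" "n_neg_eig S = 2"
  defines "L \<equiv> hamL Om S"
  shows
   "(elliptic L \<and> card (eigenvalues L) = 4 \<longrightarrow> lagr_in_cone Om S = {})
  \<and> (elliptic L \<and> (\<forall>\<mu>\<in>eigenvalues L. alg_mult L \<mu> = 2) \<and> \<not> diagonalizable_C L
       \<longrightarrow> card (lagr_in_cone Om S) = 1)
  \<and> (hyperbolic L \<and> (\<exists>\<kappa> l::real. \<kappa> \<noteq> 0 \<and> l \<noteq> 0 \<and>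
        eigenvalues L = {Complex \<kappa> l, Complex \<kappa> (-l), Complex (-\<kappa>) l, Complex (-\<kappa>) (-l)})
       \<longrightarrow> card (lagr_in_cone Om S) = 2)
  \<and> (hyperbolic L \<and> (\<exists>l::real. l \<noteq> 0 \<and>
        eigenvalues L = {complex_of_real l, complex_of_real (-l)} \<and>
        alg_mult L (complex_of_real l) = 2 \<and> alg_mult L (complex_of_real (-l)) = 2)
        \<and> \<not> diagonalizable_C L
       \<longrightarrow> card (lagr_in_cone Om S) = 3)
  \<and> (hyperbolic L \<and> card (eigenvalues L) = 4 \<and> (\<forall>\<mu>\<in>eigenvalues L. Im \<mu> = 0)
       \<longrightarrow> card (lagr_in_cone Om S) = 4)"
proof -
  interpret linear_hamiltonian Om S
    by unfold_locales (fact skew Om_nondeg symS S_nondeg)+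
  have not_semisimple: "\<exists>x. f (f x) \<noteq> s *\<^sub>R x" if "\<not> diagonalizable_C (hamL Om S)" "s \<noteq> 0" for s
    using diagonalizable_C_if_square_scalar that by blast
  have distinct: "a\<^sup>2 \<noteq> b\<^sup>2" if "eigenvalues (hamL Om S) = {a, - a, b, - b}" "card (eigenvalues (hamL Om S)) = 4"
    for a b
  proof -
    have "distinct [a, - a, b, - b]" by (rule card_distinct) (use that in simp)
    then show ?thesis by (auto simp: power2_eq_iff)
  qed
  show ?thesis
    unfolding L_def
  proof (intro conjI impI; elim conjE)
    assume ell: "elliptic (hamL Om S)" and card: "card (eigenvalues (hamL Om S)) = 4"
    obtain a b where E: "eigenvalues (hamL Om S) = {a, - a, b, - b}"
      using card by (rule eigenvalues_card_4)
    \<comment> \<open>For imaginary \<open>a\<close> and \<open>b\<close> these are the negatives of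
      the squares, so the relation factors as (X^2 + p)(X^2 + q).\<close>
    define p q where "p = (Im a)\<^sup>2" and "q = (Im b)\<^sup>2"
    have re: "Re a = 0" "Re b = 0" using ell E by (auto simp: elliptic_def)
    then have sq: "a\<^sup>2 = complex_of_real (- p)" "b\<^sup>2 = complex_of_real (- q)"
      by (simp_all add: complex_eq_iff p_def q_def power2_eq_square)
    have "charpoly (cmat (hamL Om S)) = [:complex_of_real (p * q), 0, complex_of_real (p + q), 0, 1:]"
      unfolding charpoly_simple[OF E card] sq by simp
    note CH = real_biquadratic[OF this]
    have "a \<noteq> 0" "b \<noteq> 0" using E zero_not_eigenvalue by auto
    then have "Im a \<noteq> 0" "Im b \<noteq> 0" using re by (auto simp: complex_eq_iff)
    then have pos: "0 < p" "0 < q" by (simp_all add: p_def q_def)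
    have "p \<noteq> q" using distinct[OF E card] sq by auto
    obtain x where x: "x \<noteq> 0" "f (f x) = (- p) *\<^sub>R x"
      using real_square_eigenvalue[OF _ sq(1)] E by auto
    obtain y where y: "y \<noteq> 0" "f (f y) = (- q) *\<^sub>R y"
      using real_square_eigenvalue[OF _ sq(2)] E by auto
    show "lagr_in_cone Om S = {}"
      by (rule lagr_imaginary_simple[OF CH pos \<open>p \<noteq> q\<close> x(1) _ y(1)]) (use x y in \<open>simp_all add: Q_def\<close>)
  next
    assume ell: "elliptic (hamL Om S)" and mult: "\<forall>\<mu>\<in>eigenvalues (hamL Om S). alg_mult (hamL Om S) \<mu> = 2"
      and nondiag: "\<not> diagonalizable_C (hamL Om S)"
    obtain a where a: "a \<noteq> 0" "eigenvalues (hamL Om S) = {a, - a}"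
      using mult by (rule eigenvalues_mult_2)
    define s where "s = - (Im a)\<^sup>2"
    have re: "Re a = 0" using ell a by (auto simp: elliptic_def)
    then have sq: "a\<^sup>2 = complex_of_real s"
      by (simp add: complex_eq_iff s_def power2_eq_square)
    have "Im a \<noteq> 0" using a(1) re by (auto simp: complex_eq_iff)
    then have "s < 0" by (simp add: s_def)
    have "charpoly (cmat (hamL Om S)) = [:complex_of_real (s\<^sup>2), 0, complex_of_real (- (2 * s)), 0, 1:]"
      using charpoly_double[OF a(2,1)] mult sq by simp
    from real_biquadratic[OF this]
    have CH: "f (f (f (f v))) - (2 * s) *\<^sub>R f (f v) + s\<^sup>2 *\<^sub>R v = 0" for v by simp
    obtain x where "f (f x) \<noteq> s *\<^sub>R x" using not_semisimple[OF nondiag, of s] \<open>s < 0\<close> by auto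
    then show "card (lagr_in_cone Om S) = 1"
      using lagr_imaginary_double CH \<open>s < 0\<close> by blast
  next
    assume "\<exists>\<kappa> l::real. \<kappa> \<noteq> 0 \<and> l \<noteq> 0 \<and> eigenvalues (hamL Om S)
        = {Complex \<kappa> l, Complex \<kappa> (-l), Complex (-\<kappa>) l, Complex (-\<kappa>) (-l)}"
    then obtain \<kappa> l :: real where kl: "\<kappa> \<noteq> 0" "l \<noteq> 0"
      and E: "eigenvalues (hamL Om S) = {Complex \<kappa> l, Complex \<kappa> (-l), Complex (-\<kappa>) l, Complex (-\<kappa>) (-l)}"
      by blast
    have E': "eigenvalues (hamL Om S) = {Complex \<kappa> l, - Complex \<kappa> l, Complex \<kappa> (- l), - Complex \<kappa> (- l)}"
      unfolding E by (auto simp: complex_eq_iff)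
    have card: "card (eigenvalues (hamL Om S)) = 4"
      unfolding E using kl by (simp add: card_insert_if)
    \<comment> \<open>Conjugate pairs give the real factors X^2 - 2\<kappa>X + \<kappa>^2 + l^2 and
      its mirror image, so k = 2\<kappa> and r = \<kappa>^2 + l^2; the discriminant condition then
      amounts to \<open>l\<close> being nonzero.\<close>
    have "charpoly (cmat (hamL Om S)) = [:complex_of_real ((\<kappa>\<^sup>2 + l\<^sup>2)\<^sup>2), 0,
        complex_of_real (2 * (\<kappa>\<^sup>2 + l\<^sup>2) - (2 * \<kappa>)\<^sup>2), 0, 1:]"
      unfolding charpoly_simple[OF E' card]
      by (simp add: complex_eq_iff power2_eq_square algebra_simps)
    note CH = real_biquadratic[OF this]
    show "card (lagr_in_cone Om S) = 2"
      by (rule lagr_complex_quadruple[OF CH]) (use kl in \<open>simp_all add: power_mult_distrib\<close>)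
  next
    assume "\<exists>l::real. l \<noteq> 0 \<and> eigenvalues (hamL Om S) = {complex_of_real l, complex_of_real (-l)} \<and>
        alg_mult (hamL Om S) (complex_of_real l) = 2 \<and> alg_mult (hamL Om S) (complex_of_real (-l)) = 2"
      and nondiag: "\<not> diagonalizable_C (hamL Om S)"
    then obtain l :: real where l: "l \<noteq> 0"
      and E: "eigenvalues (hamL Om S) = {complex_of_real l, - complex_of_real l}"
      and mult: "\<And>\<mu>. \<mu> \<in> eigenvalues (hamL Om S) \<Longrightarrow> alg_mult (hamL Om S) \<mu> = 2"
      by auto
    have "charpoly (cmat (hamL Om S)) = [:complex_of_real ((l\<^sup>2)\<^sup>2), 0, complex_of_real (- (2 * l\<^sup>2)), 0, 1:]"
      using charpoly_double[OF E _ mult] l by simp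
    from real_biquadratic[OF this]
    have CH: "f (f (f (f v))) - (2 * l\<^sup>2) *\<^sub>R f (f v) + (l\<^sup>2)\<^sup>2 *\<^sub>R v = 0" for v by simp
    obtain x where "f (f x) \<noteq> l\<^sup>2 *\<^sub>R x" using not_semisimple[OF nondiag, of "l\<^sup>2"] l by auto
    then show "card (lagr_in_cone Om S) = 3"
      using lagr_real_double CH l by blast
  next
    assume card: "card (eigenvalues (hamL Om S)) = 4" and real: "\<forall>\<mu>\<in>eigenvalues (hamL Om S). Im \<mu> = 0"
    obtain a b where E: "eigenvalues (hamL Om S) = {a, - a, b, - b}"
      using card by (rule eigenvalues_card_4)
    then have "a = complex_of_real (Re a)" "b = complex_of_real (Re b)"
      using real by (auto simp: complex_eq_iff)
    then obtain \<alpha> \<beta> where ab: "a = complex_of_real \<alpha>" "b = complex_of_real \<beta>" by blast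
    have "charpoly (cmat (hamL Om S))
        = [:complex_of_real (\<alpha>\<^sup>2 * \<beta>\<^sup>2), 0, complex_of_real (- (\<alpha>\<^sup>2 + \<beta>\<^sup>2)), 0, 1:]"
      unfolding charpoly_simple[OF E card] ab by simp
    from real_biquadratic[OF this]
    have CH: "f (f (f (f v))) - (\<alpha>\<^sup>2 + \<beta>\<^sup>2) *\<^sub>R f (f v) + (\<alpha>\<^sup>2 * \<beta>\<^sup>2) *\<^sub>R v = 0" for v
      by (metis add_uminus_conv_diff scaleR_minus_left)
    show "card (lagr_in_cone Om S) = 4"
    proof (rule lagr_real_simple[OF CH])
      show "\<alpha> \<noteq> 0" "\<beta> \<noteq> 0" using E ab zero_not_eigenvalue by auto
      show "\<alpha>\<^sup>2 \<noteq> \<beta>\<^sup>2" using distinct[OF E card] ab by (metis of_real_power)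
      show "\<exists>x. x \<noteq> 0 \<and> f x = c *\<^sub>R x" if "c\<^sup>2 \<in> {\<alpha>\<^sup>2, \<beta>\<^sup>2}" for c
      proof -
        have "complex_of_real c \<in> eigenvalues (hamL Om S)"
          unfolding E ab using that by (auto simp: power2_eq_iff)
        then show ?thesis by (rule real_eigenvalue) blast
      qed
    qed
  qed
qed

end
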